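(* Let $\gamma>0$, $\omega>0$, $n\ge 1$, and let $\tau_1,\dots,\tau_n>0$. Assume that $f:\mathbb{R}^n\to\mathbb{R}$ is locally Lipschitz continuous, that $g:\mathbb{R}\times[0,1]\to\mathbb{R}$ is Hölder continuous, and that $g(t,x)$ is $\omega$-periodic in $t$. Suppose that there exist positive constants $\beta_1,\dots,\beta_n$ such that $$|f(\xi_1,\dots,\xi_n)-f(\eta_1,\dots,\eta_n)|\le \sum_{k=1}^n\beta_k|\xi_k-\eta_k|\qquad\text{for all }(\xi_1,\dots,\xi_n),(\eta_1,\dots,\eta_n)\in\mathbb{R}^n,$$ and $$\sum_{k=1}^n\beta_k<\gamma\pi^4+\pi^2-1.$$ Then the delayed extended Fisher-Kolmogorov problem $$\begin{cases}\dfrac{\partial}{\partial t}u(t,x)+\gamma\dfrac{\partial^4}{\partial x^4}u(t,x)-\dfrac{\partial^2}{\partial x^2}u(t,x)-u(t,x)=g(t,x)+f(u(t-\tau_1,x),\dots,u(t-\tau_n,x)) & \text{in }\mathbb{R}\times(0,1),\\[4pt] u(t,0)=u(t,1)=0,\quad u_{xx}(t,0)=u_{xx}(t,1)=0, & t\in\mathbb{R},\end{cases}$$ has a unique time $\omega$-periodic classical solution $u\in C^{1,2}(\mathbb{R}\times[0,1])$.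
   Context: $C^{1,2}(\mathbb{R}\times[0,1])$ denotes the functions $u(t,x)$ that are continuously differentiable once in $t$ and twice in $x$ on $\mathbb{R}\times[0,1]$. A classical solution is a function for which all derivatives appearing in the equation exist and which satisfies the equation and the boundary conditions pointwise. Time $\omega$-periodic means $u(t+\omega,x)=u(t,x)$ for all $t,x$. *)

theory Defs
  imports "HOL-Analysis.Analysis"
begin

text \<open>The library's \<^const>\<open>local_lipschitz\<close> concerns families of functions; a single function
  is the family that is constant in a dummy parameter.\<close>

definition locally_lipschitz_on :: "'a::metric_space set \<Rightarrow> ('a \<Rightarrow> 'b::metric_space) \<Rightarrow> bool" where
  "locally_lipschitz_on X f \<longleftrightarrow> local_lipschitz (UNIV :: real set) X (\<lambda>_. f)"

definition hoelder_continuous_on :: "'a::metric_space set \<Rightarrow> ('a \<Rightarrow> 'b::metric_space) \<Rightarrow> bool" where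
  "hoelder_continuous_on S h \<longleftrightarrow>
    (\<exists>\<alpha> C. 0 < \<alpha> \<and> \<alpha> \<le> 1 \<and> (\<forall>p\<in>S. \<forall>q\<in>S. dist (h p) (h q) \<le> C * dist p q powr \<alpha>))"

text \<open>Functions on the strip \<open>\<real> \<times> [0,1]\<close> are represented by total functions
  \<open>real \<Rightarrow> real \<Rightarrow> real\<close> (time first), of which only the values for \<open>x \<in> [0,1]\<close> matter.\<close>

definition time_periodic :: "real \<Rightarrow> (real \<Rightarrow> real \<Rightarrow> real) \<Rightarrow> bool" where
  "time_periodic \<omega> u \<longleftrightarrow> (\<forall>t. \<forall>x\<in>{0..1}. u (t + \<omega>) x = u t x)"

text \<open>The space \<open>C\<^sup>1\<^sup>,\<^sup>2(\<real> \<times> [0,1])\<close>; spatial derivatives at \<open>x = 0\<close> and \<open>x = 1\<close> are one-sided.\<close>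

definition C12 :: "(real \<Rightarrow> real \<Rightarrow> real) \<Rightarrow> bool" where
  "C12 u \<longleftrightarrow> (\<exists>ut ux uxx.
    (\<forall>t. \<forall>x\<in>{0..1}.
      ((\<lambda>s. u s x) has_real_derivative ut t x) (at t) \<and>
      (u t has_real_derivative ux t x) (at x within {0..1}) \<and>
      (ux t has_real_derivative uxx t x) (at x within {0..1})) \<and>
    continuous_on (UNIV \<times> {0..1}) (\<lambda>(t, x). u t x) \<and>
    continuous_on (UNIV \<times> {0..1}) (\<lambda>(t, x). ut t x) \<and>
    continuous_on (UNIV \<times> {0..1}) (\<lambda>(t, x). ux t x) \<and>
    continuous_on (UNIV \<times> {0..1}) (\<lambda>(t, x). uxx t x))"

text \<open>Classical solutions of the delayed extended Fisher-Kolmogorov problem. The first two spatial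
  derivatives are required on all of \<open>[0,1]\<close> (one-sided at the ends), since \<open>u\<^sub>x\<^sub>x\<close> enters the boundary
  conditions; the time derivative and the third and fourth spatial derivatives only inside. The
  bound functions \<open>ut\<close>, \<open>ux\<close>, \<dots> are determined by \<open>u\<close> at the points where they are used.\<close>

definition efk_classical_solution ::
  "real \<Rightarrow> ('n::finite \<Rightarrow> real) \<Rightarrow> (real^'n \<Rightarrow> real) \<Rightarrow> (real \<Rightarrow> real \<Rightarrow> real) \<Rightarrow> (real \<Rightarrow> real \<Rightarrow> real) \<Rightarrow> bool"
where
  "efk_classical_solution \<gamma> \<tau> f g u \<longleftrightarrow> (\<exists>ut ux uxx uxxx uxxxx.
    (\<forall>t. \<forall>x\<in>{0..1}.
      (u t has_real_derivative ux t x) (at x within {0..1}) \<and>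
      (ux t has_real_derivative uxx t x) (at x within {0..1})) \<and>
    (\<forall>t. \<forall>x\<in>{0<..<1}.
      ((\<lambda>s. u s x) has_real_derivative ut t x) (at t) \<and>
      (uxx t has_real_derivative uxxx t x) (at x) \<and>
      (uxxx t has_real_derivative uxxxx t x) (at x) \<and>
      ut t x + \<gamma> * uxxxx t x - uxx t x - u t x = g t x + f (\<chi> k. u (t - \<tau> k) x)) \<and>
    (\<forall>t. u t 0 = 0 \<and> u t 1 = 0 \<and> uxx t 0 = 0 \<and> uxx t 1 = 0))"

end

theory Submission
  imports Defs "HOL-Real_Asymp.Real_Asymp"
begin

text \<open>
  Put \<open>\<kappa>\<^sub>k = (k + 1) \<pi>\<close>. The functions \<open>sin (\<kappa>\<^sub>k x)\<close> diagonalise \<open>\<gamma> \<partial>\<^sub>x\<^sup>4 - \<partial>\<^sub>x\<^sup>2 - 1\<close> under the given boundary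
  conditions; the eigenvalues are \<open>\<lambda>\<^sub>k = \<gamma> \<kappa>\<^sub>k\<^sup>4 + \<kappa>\<^sub>k\<^sup>2 - 1\<close>, and \<open>\<lambda>\<^sub>0 = \<gamma> \<pi>\<^sup>4 + \<pi>\<^sup>2 - 1\<close> is the smallest. For
  a continuous \<open>\<omega>\<close>-periodic right-hand side \<open>h\<close> with sine coefficients \<open>h\<^sub>k(t)\<close>, the only candidate for
  a periodic solution of the linear problem is \<open>\<Sum>\<^sub>k u\<^sub>k(t) sin (\<kappa>\<^sub>k x)\<close>, where \<open>u\<^sub>k\<close> is the unique
  \<open>\<omega>\<close>-periodic solution of \<open>u\<^sub>k' + \<lambda>\<^sub>k u\<^sub>k = h\<^sub>k\<close>. This series is the mild solution of the linear problem.

  Existence and uniqueness come from a contraction. In the norm \<open>sup\<^sub>t \<parallel>\<cdot>\<parallel>\<close> with the \<open>L\<^sup>2(0,1)\<close> norm inside,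
  the linear solution operator has norm at most \<open>1 / \<lambda>\<^sub>0\<close> (lemma \<open>mild_L2_le\<close>), and the delayed
  nonlinearity is Lipschitz with constant \<open>\<Sum> \<beta>\<^sub>k\<close>, because a time shift does not change a supremum over
  \<open>t\<close> (\<open>source_L2_lipschitz\<close>). The hypothesis says that the product of the two constants is below \<open>1\<close>.
  The linear operator also maps this norm boundedly into the supremum norm (\<open>mild_sup_le\<close>), since
  \<open>\<Sum> 1 / \<lambda>\<^sub>k\<close> converges. Hence the Picard iterates, which contract only in the weak norm, converge
  uniformly, and the whole argument takes place among continuous functions.

  What remains is regularity of the mild solution. As \<open>\<lambda>\<^sub>k\<close> grows like \<open>k\<^sup>4\<close>, the series for \<open>u\<close>, \<open>u\<^sub>x\<close> and
  \<open>u\<^sub>x\<^sub>x\<close> converge absolutely for every bounded \<open>h\<close>, and \<open>u\<close> is Hoelder continuous in time, so that the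
  right-hand side belonging to a fixed point is Hoelder continuous in time with some exponent \<open>\<alpha> > 0\<close>.
  The delicate point is \<open>u\<^sub>t\<close>: its coefficients are only of order \<open>k powr (- 4 \<alpha>)\<close>, so for small \<open>\<alpha>\<close> its
  series need not converge absolutely. Summation by parts in \<open>k\<close> helps. The partial sums of the
  sine series of a bounded function grow only logarithmically (\<open>sine_partial_sum_bound\<close>), while
  changing the rate from \<open>\<lambda>\<^sub>k\<close> to \<open>\<lambda>\<^bsub>k+1\<^esub>\<close> changes the derivative of a response very little
  (\<open>periodic_response_rate_change\<close>); so the series of \<open>u\<^sub>t\<close> converges uniformly up to the boundary
  (\<open>mode_derivative_series_converges\<close>). Finally \<open>(h - u\<^sub>t + u\<^sub>x\<^sub>x + u) / \<gamma>\<close> is continuous and has the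
  sine coefficients that a second derivative of \<open>u\<^sub>x\<^sub>x\<close> must have, and by completeness of the sine
  system it is that second derivative (\<open>weak_second_derivative_imp_strong\<close>).

  Conversely, two integrations by parts show that every periodic classical solution is a fixed
  point of the same map (\<open>classical_imp_mild\<close>), which gives uniqueness.
\<close>

section \<open>Periodic solutions of scalar linear equations\<close>

lemma periodic_int_shift:
  fixes y :: "real \<Rightarrow> 'a"
  assumes "\<And>t. y (t + \<omega>) = y t"
  shows "y (t + of_int n * \<omega>) = y t"
proof -
  have nat: "y (t + real m * \<omega>) = y t" for t m
  proof (induction m)
    case (Suc m)
    have "t + real (Suc m) * \<omega> = (t + real m * \<omega>) + \<omega>" by (simp add: algebra_simps)
    then show ?case using Suc assms by metis
  qed simp
  show ?thesis
  proof (cases "n \<ge> 0")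
    case True
    then show ?thesis using nat[of t "nat n"] by simp
  next
    case False
    then have "real (nat (- n)) = - of_int n" by simp
    then show ?thesis using nat[of "t + of_int n * \<omega>" "nat (- n)"] by (simp add: algebra_simps)
  qed
qed

lemma periodic_representative:
  fixes y :: "real \<Rightarrow> 'a"
  assumes "\<omega> > 0" "\<And>t. y (t + \<omega>) = y t"
  obtains s where "s \<in> {0..\<omega>}" "y t = y s"
proof
  let ?n = "\<lfloor>t / \<omega>\<rfloor>"
  have "of_int ?n * \<omega> \<le> t" "t \<le> (of_int ?n + 1) * \<omega>"
    using assms(1) by (simp_all add: pos_le_divide_eq[symmetric] pos_divide_le_eq[symmetric])
  then show "t + of_int (- ?n) * \<omega> \<in> {0..\<omega>}" by (simp add: algebra_simps)
  show "y t = y (t + of_int (- ?n) * \<omega>)"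
    by (rule periodic_int_shift[of y, OF assms(2), symmetric])
qed

text \<open>The substitute for an improper integral over the past: all bounds on periodic solutions below come
  from evaluating a differential equation at a maximum point, where the derivative vanishes.\<close>

lemma periodic_attains_max:
  fixes y :: "real \<Rightarrow> real"
  assumes "\<omega> > 0" "\<And>t. y (t + \<omega>) = y t" "\<And>t. (y has_real_derivative y' t) (at t)"
  obtains t0 where "\<And>t. y t \<le> y t0" "y' t0 = 0"
proof -
  have "continuous_on {0..\<omega>} y"
    using assms(3) DERIV_isCont by (intro continuous_at_imp_continuous_on) blast
  then obtain t0 where t0: "t0 \<in> {0..\<omega>}" "\<forall>t\<in>{0..\<omega>}. y t \<le> y t0"
    using continuous_attains_sup[of "{0..\<omega>}" y] \<open>\<omega> > 0\<close> by auto
  have max: "y t \<le> y t0" for t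
    using periodic_representative[of \<omega> y t] assms t0 by metis
  moreover have "y' t0 = 0"
    using DERIV_local_max[OF assms(3), of 1] max by auto
  ultimately show thesis using that by blast
qed

definition periodic_response :: "real \<Rightarrow> real \<Rightarrow> (real \<Rightarrow> real) \<Rightarrow> (real \<Rightarrow> real) \<Rightarrow> bool" where
  "periodic_response \<omega> a h v \<longleftrightarrow>
    (\<forall>t. v (t + \<omega>) = v t) \<and> (\<forall>t. (v has_real_derivative h t - a * v t) (at t))"

lemma periodic_response_periodic: "periodic_response \<omega> a h v \<Longrightarrow> v (t + \<omega>) = v t"
  and periodic_response_DERIV:
    "periodic_response \<omega> a h v \<Longrightarrow> (v has_real_derivative h t - a * v t) (at t)"
  by (auto simp: periodic_response_def)

lemma periodic_response_continuous:
  "periodic_response \<omega> a h v \<Longrightarrow> continuous_on S v"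
  using periodic_response_DERIV DERIV_isCont by (intro continuous_at_imp_continuous_on) blast

lemma periodic_response_diff:
  assumes "periodic_response \<omega> a h v" "periodic_response \<omega> a k w"
  shows "periodic_response \<omega> a (\<lambda>t. h t - k t) (\<lambda>t. v t - w t)"
  using assms unfolding periodic_response_def
  by (auto intro!: derivative_eq_intros simp: algebra_simps)

lemma periodic_response_cmult:
  assumes "periodic_response \<omega> a h v"
  shows "periodic_response \<omega> a (\<lambda>t. c * h t) (\<lambda>t. c * v t)"
  using assms unfolding periodic_response_def
  by (auto intro!: derivative_eq_intros simp: algebra_simps)

lemma periodic_response_shift:
  assumes "periodic_response \<omega> a h v"
  shows "periodic_response \<omega> a (\<lambda>t. h (t + \<delta>)) (\<lambda>t. v (t + \<delta>))"
proof -
  have "v (t + \<omega> + \<delta>) = v (t + \<delta>)" for t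
    using periodic_response_periodic[OF assms, of "t + \<delta>"] by (simp add: algebra_simps)
  moreover have "((\<lambda>t. v (t + \<delta>)) has_real_derivative h (t + \<delta>) - a * v (t + \<delta>)) (at t)" for t
    using periodic_response_DERIV[OF assms, of "t + \<delta>"] by (simp add: DERIV_shift)
  ultimately show ?thesis by (simp add: periodic_response_def)
qed

text \<open>At a maximum of \<open>y = \<Sum> v\<^sub>k\<^sup>2\<close> the equations give \<open>\<Sum> a\<^sub>k v\<^sub>k\<^sup>2 = \<Sum> v\<^sub>k h\<^sub>k\<close>, and the right-hand side is at most
  \<open>sqrt y * M\<close> by Cauchy-Schwarz. Taken over the sine modes this is the \<open>L\<^sup>2\<close> bound with the constant
  \<open>1 / \<lambda>\<^sub>0\<close>; the case of one index is the ordinary maximum principle.\<close>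

lemma sum_squares_periodic_response_le:
  fixes v h :: "nat \<Rightarrow> real \<Rightarrow> real"
  assumes "\<omega> > 0" "finite I" "b > 0"
    and resp: "\<And>k. k \<in> I \<Longrightarrow> periodic_response \<omega> (a k) (h k) (v k)"
    and ab: "\<And>k. k \<in> I \<Longrightarrow> b \<le> a k"
    and M: "\<And>t. (\<Sum>k\<in>I. (h k t)\<^sup>2) \<le> M\<^sup>2"
  shows "(\<Sum>k\<in>I. (v k t)\<^sup>2) \<le> (M / b)\<^sup>2"
proof -
  let ?y = "\<lambda>t. \<Sum>k\<in>I. (v k t)\<^sup>2"
  let ?y' = "\<lambda>t. \<Sum>k\<in>I. 2 * v k t * (h k t - a k * v k t)"
  have per: "?y (t + \<omega>) = ?y t" for t
    using periodic_response_periodic[OF resp] by simp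
  have der: "(?y has_real_derivative ?y' t) (at t)" for t
    by (rule DERIV_sum)
      (use periodic_response_DERIV[OF resp] in \<open>auto intro!: derivative_eq_intros simp: power2_eq_square\<close>)
  obtain t0 where t0: "\<And>t. ?y t \<le> ?y t0" "?y' t0 = 0"
    using periodic_attains_max[of \<omega> ?y ?y', OF \<open>\<omega> > 0\<close> per der] by blast
  have nn: "0 \<le> ?y t0" by (simp add: sum_nonneg)
  have "b * ?y t0 \<le> (\<Sum>k\<in>I. a k * (v k t0)\<^sup>2)"
    unfolding sum_distrib_left by (intro sum_mono mult_right_mono ab) auto
  also have "\<dots> = (\<Sum>k\<in>I. v k t0 * h k t0)"
  proof -
    have "?y' t0 = 2 * ((\<Sum>k\<in>I. v k t0 * h k t0) - (\<Sum>k\<in>I. a k * (v k t0)\<^sup>2))"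
      unfolding sum_subtractf[symmetric] sum_distrib_left
      by (intro sum.cong) (auto simp: algebra_simps power2_eq_square)
    then show ?thesis using t0(2) by simp
  qed
  finally have "b * ?y t0 \<le> (\<Sum>k\<in>I. v k t0 * h k t0)" .
  then have "(b * ?y t0)\<^sup>2 \<le> (\<Sum>k\<in>I. v k t0 * h k t0)\<^sup>2"
    using nn \<open>b > 0\<close> by (intro power_mono) auto
  also have "\<dots> \<le> ?y t0 * (\<Sum>k\<in>I. (h k t0)\<^sup>2)" by (rule Cauchy_Schwarz_ineq_sum)
  also have "\<dots> \<le> ?y t0 * M\<^sup>2" using M nn by (intro mult_left_mono) auto
  finally have "?y t0 * (b\<^sup>2 * ?y t0) \<le> ?y t0 * M\<^sup>2" by (simp add: power2_eq_square mult_ac)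
  then have "b\<^sup>2 * ?y t0 \<le> M\<^sup>2" using nn by (cases "?y t0 = 0") auto
  then have "?y t0 \<le> (M / b)\<^sup>2" using \<open>b > 0\<close> by (simp add: field_simps)
  then show ?thesis using t0(1)[of t] by linarith
qed

lemma periodic_response_bound:
  assumes "\<omega> > 0" "a > 0" "periodic_response \<omega> a h v" "\<And>t. \<bar>h t\<bar> \<le> M"
  shows "\<bar>v t\<bar> \<le> M / a"
proof -
  have "M \<ge> 0" using assms(4)[of 0] by linarith
  have "(h t)\<^sup>2 \<le> M\<^sup>2" for t using power_mono[OF assms(4), of t 2] by simp
  then have "(v t)\<^sup>2 \<le> (M / a)\<^sup>2"
    using sum_squares_periodic_response_le[of \<omega> "{0}" a "\<lambda>_. a" "\<lambda>_. h" "\<lambda>_. v" M t] assms by simp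
  then show ?thesis using \<open>M \<ge> 0\<close> \<open>a > 0\<close> by (simp add: abs_le_square_iff[symmetric])
qed

lemma periodic_response_unique:
  assumes "\<omega> > 0" "a > 0" "periodic_response \<omega> a h v" "periodic_response \<omega> a h w"
  shows "v = w"
  using periodic_response_bound[OF assms(1,2) periodic_response_diff[OF assms(3,4)], of 0] by auto

text \<open>Variation of constants over one period:
  \<open>v(t) = (\<integral>\<^bsub>t-\<omega>\<^esub>\<^bsup>t\<^esup> exp (- a (t - s)) h(s) ds) / (1 - exp (- a \<omega>))\<close>.\<close>

lemma periodic_response_exists:
  assumes "\<omega> > 0" "a > 0" "continuous_on UNIV h" "\<And>t. h (t + \<omega>) = h t"
  shows "\<exists>v. periodic_response \<omega> a h v"
proof -
  let ?H = "\<lambda>s. exp (a * s) * h s"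
  let ?c = "1 - exp (- a * \<omega>)"
  define K where "K = 1 / ?c"
  define v where "v t = K * (exp (- a * t) * integral {t - \<omega>..t} ?H)" for t
  have c: "?c \<noteq> 0" using assms by simp
  have cont: "continuous_on S ?H" for S
    by (intro continuous_intros continuous_on_subset[OF assms(3)]) auto
  have Hshift: "?H (t - \<omega>) = exp (- a * \<omega>) * ?H t" for t
    using assms(4)[of "t - \<omega>"] by (simp add: exp_diff[symmetric] exp_add[symmetric] algebra_simps)
  have der: "(v has_real_derivative h t - a * v t) (at t)" for t
  proof -
    \<comment> \<open>near \<open>t\<close> the integral over the moving window is a difference of two values of one antiderivative\<close>
    let ?l = "t - \<omega> - 1"
    let ?G = "\<lambda>x. integral {?l..x} ?H"
    have G: "(?G has_real_derivative ?H x) (at x)" if "x \<in> {?l<..<t + 1}" for x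
      using integral_has_real_derivative[OF cont, of x ?l "t + 1"] that
        at_within_Icc_at[of ?l x "t + 1"] by simp
    have G2: "((\<lambda>x. ?G (x - \<omega>)) has_real_derivative ?H (t - \<omega>)) (at t)"
      using DERIV_shift[of ?G _ t "- \<omega>"] G[of "t - \<omega>"] \<open>\<omega> > 0\<close> by simp
    let ?D = "K * (exp (- a * t) * (?H t - ?H (t - \<omega>)) - a * exp (- a * t) * (?G t - ?G (t - \<omega>)))"
    have E: "((\<lambda>x. exp (- a * x)) has_real_derivative - a * exp (- a * t)) (at t)"
      by (auto intro!: derivative_eq_intros)
    have t: "t \<in> {?l<..<t + 1}" using \<open>\<omega> > 0\<close> by simp
    have d: "((\<lambda>x. K * (exp (- a * x) * (?G x - ?G (x - \<omega>)))) has_real_derivative ?D) (at t)"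
      using DERIV_cmult[OF DERIV_mult[OF E DERIV_diff[OF G[OF t] G2]], of K] by (simp add: algebra_simps)
    have GI: "?G x - ?G (x - \<omega>) = integral {x - \<omega>..x} ?H" if "\<bar>x - t\<bar> < 1" for x
    proof -
      have "?G (x - \<omega>) + integral {x - \<omega>..x} ?H = ?G x"
        by (rule Henstock_Kurzweil_Integration.integral_combine)
          (use that \<open>\<omega> > 0\<close> integrable_continuous_real[OF cont] in \<open>auto simp: abs_if split: if_splits\<close>)
      then show ?thesis by linarith
    qed
    have ev: "eventually (\<lambda>x. K * (exp (- a * x) * (?G x - ?G (x - \<omega>))) = v x) (nhds t)"
      unfolding eventually_nhds_metric by (intro exI[of _ 1]) (use GI in \<open>auto simp: v_def dist_real_def\<close>)
    have "(v has_real_derivative ?D) (at t)"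
      by (rule DERIV_cong_ev[OF refl ev refl, THEN iffD1, OF d])
    moreover have "?D = h t - a * v t"
    proof -
      have "exp (- a * t) * (?H t - ?H (t - \<omega>)) = h t * ?c"
      proof -
        have "exp (- a * t) * (?H t - ?H (t - \<omega>)) = (exp (- a * t) * exp (a * t)) * (h t * ?c)"
          unfolding Hshift[of t] by (simp only: algebra_simps)
        also have "exp (- a * t) * exp (a * t) = 1" by (simp add: mult_exp_exp)
        finally show ?thesis by simp
      qed
      then have "K * (exp (- a * t) * (?H t - ?H (t - \<omega>))) = h t"
        using c by (simp add: K_def)
      moreover have "K * (a * exp (- a * t) * (?G t - ?G (t - \<omega>))) = a * v t"
        using GI[of t] by (simp add: v_def)
      ultimately show ?thesis by (simp add: right_diff_distrib)
    qed
    ultimately show ?thesis by simp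
  qed
  have "v (t + \<omega>) = v t" for t
  proof -
    have "integral {t..t + \<omega>} ?H = integral {t - \<omega>..t} (\<lambda>s. ?H (s + \<omega>))"
      using integral_shift_real_ivl[of t \<omega> "t + \<omega>" ?H] by simp
    also have "(\<lambda>s. ?H (s + \<omega>)) = (\<lambda>s. exp (a * \<omega>) * ?H s)"
      using assms(4) by (simp add: distrib_left exp_add mult.commute mult.left_commute)
    finally have "integral {t..t + \<omega>} ?H = exp (a * \<omega>) * integral {t - \<omega>..t} ?H" by simp
    moreover have "exp (- a * (t + \<omega>)) * exp (a * \<omega>) = exp (- a * t)"
      unfolding mult_exp_exp by (simp add: algebra_simps)
    ultimately show ?thesis by (simp add: v_def mult.assoc[symmetric])
  qed
  with der show ?thesis unfolding periodic_response_def by blast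
qed

text \<open>The time shift of a response is the response to the shifted data, so the sup bound applies to the
  difference of the two.\<close>

lemma periodic_response_hoelder:
  assumes "\<omega> > 0" "a > 0" "periodic_response \<omega> a h v"
    and h: "\<And>s t. \<bar>h s - h t\<bar> \<le> L * \<bar>s - t\<bar> powr \<alpha>"
  shows "\<bar>v s - v t\<bar> \<le> L * \<bar>s - t\<bar> powr \<alpha> / a"
proof -
  have "periodic_response \<omega> a (\<lambda>r. h (r + (s - t)) - h r) (\<lambda>r. v (r + (s - t)) - v r)"
    by (intro periodic_response_diff periodic_response_shift assms(3))
  from periodic_response_bound[OF assms(1,2) this, of "L * \<bar>s - t\<bar> powr \<alpha>" t] h
  show ?thesis by (metis add_diff_cancel_left' add.commute diff_add_cancel)
qed

text \<open>On the time scale \<open>\<delta> = 1 / a\<close> both \<open>h\<close> and \<open>a v\<close> move by at most \<open>L \<delta> powr \<alpha>\<close>, hence so does, up to a factor,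
  \<open>v' = h - a v\<close>; and by the mean value theorem \<open>v'\<close> is itself that small somewhere within that time.
  The sup bound alone would give no decay in \<open>a\<close>.\<close>

lemma periodic_response_DERIV_bound:
  assumes "\<omega> > 0" "a > 0" "\<alpha> > 0" "L \<ge> 0" "periodic_response \<omega> a h v"
    and h: "\<And>s t. \<bar>h s - h t\<bar> \<le> L * \<bar>s - t\<bar> powr \<alpha>"
  shows "\<bar>h t - a * v t\<bar> \<le> 3 * L * a powr - \<alpha>"
proof -
  let ?\<delta> = "1 / a"
  let ?K = "L * a powr - \<alpha>"
  have \<delta>: "?\<delta> powr \<alpha> = a powr - \<alpha>" using \<open>a > 0\<close> by (simp add: powr_divide powr_minus_divide)
  obtain z where z: "t < z" "z < t + ?\<delta>" "v (t + ?\<delta>) - v t = (t + ?\<delta> - t) * (h z - a * v z)"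
    using MVT2[of t "t + ?\<delta>" v "\<lambda>z. h z - a * v z"] periodic_response_DERIV[OF assms(5)] \<open>a > 0\<close>
    by auto
  have v: "\<bar>v r - v t\<bar> \<le> ?K / a" and h': "\<bar>h r - h t\<bar> \<le> ?K" if "t \<le> r" "r \<le> t + ?\<delta>" for r
  proof -
    have "\<bar>r - t\<bar> powr \<alpha> \<le> ?\<delta> powr \<alpha>" using that \<open>\<alpha> > 0\<close> by (intro powr_mono2) auto
    then have le: "L * \<bar>r - t\<bar> powr \<alpha> \<le> ?K" using \<open>L \<ge> 0\<close> \<delta> by (simp add: mult_left_mono)
    show "\<bar>h r - h t\<bar> \<le> ?K" using h[of r t] le by linarith
    show "\<bar>v r - v t\<bar> \<le> ?K / a"
      using periodic_response_hoelder[OF assms(1,2,5) h, of r t] divide_right_mono[OF le, of a] \<open>a > 0\<close>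
      by linarith
  qed
  have "h z - a * v z = a * (v (t + ?\<delta>) - v t)" using z(3) \<open>a > 0\<close> by (simp add: field_simps)
  then have "\<bar>h z - a * v z\<bar> \<le> a * (?K / a)"
    using v[of "t + ?\<delta>"] \<open>a > 0\<close> by (simp add: abs_mult mult_left_mono del: times_divide_eq_right)
  moreover have "\<bar>h z - h t\<bar> \<le> ?K" using h' z by simp
  moreover have "\<bar>a * v z - a * v t\<bar> \<le> a * (?K / a)"
    using v[of z] z \<open>a > 0\<close> by (simp add: right_diff_distrib[symmetric] abs_mult mult_left_mono del: times_divide_eq_right)
  moreover have "a * (?K / a) = ?K" using \<open>a > 0\<close> by simp
  ultimately have "\<bar>h z - a * v z\<bar> \<le> ?K" "\<bar>h z - h t\<bar> \<le> ?K" "\<bar>a * v z - a * v t\<bar> \<le> ?K"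
    by simp_all
  then show ?thesis by linarith
qed

text \<open>The difference \<open>v - w\<close> is the response at rate \<open>a\<close> to \<open>(b - a) w\<close>, and \<open>w\<close> is Lipschitz with the constant
  that the preceding lemma provides; a second use of that lemma with exponent \<open>1\<close> gives the gain
  \<open>(b - a) / a\<close>, which makes the sum over consecutive rates converge.\<close>

lemma periodic_response_rate_change:
  assumes "\<omega> > 0" "0 < a" "a \<le> b" "\<alpha> > 0" "L \<ge> 0"
    and v: "periodic_response \<omega> a h v" and w: "periodic_response \<omega> b h w"
    and h: "\<And>s t. \<bar>h s - h t\<bar> \<le> L * \<bar>s - t\<bar> powr \<alpha>"
  shows "\<bar>(h t - a * v t) - (h t - b * w t)\<bar> \<le> 9 * L * (b - a) / a * b powr - \<alpha>"
proof -
  let ?K = "3 * L * b powr - \<alpha>"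
  have b: "b > 0" using assms by simp
  have K: "?K \<ge> 0" using \<open>L \<ge> 0\<close> by simp
  have e: "periodic_response \<omega> a (\<lambda>t. (b - a) * w t) (\<lambda>t. v t - w t)"
    using v w unfolding periodic_response_def by (auto intro!: derivative_eq_intros simp: algebra_simps)
  have "\<bar>w s - w t\<bar> \<le> ?K * \<bar>s - t\<bar>" for s t
  proof (rule field_differentiable_bound[where S = UNIV and f' = "\<lambda>t. h t - b * w t", simplified real_norm_def])
    show "(w has_field_derivative h z - b * w z) (at z within UNIV)" for z
      using periodic_response_DERIV[OF w] by simp
    show "\<bar>h z - b * w z\<bar> \<le> ?K" for z
      by (rule periodic_response_DERIV_bound[OF assms(1) b assms(4,5) w h])
  qed auto
  then have "\<bar>(b - a) * w s - (b - a) * w t\<bar> \<le> ((b - a) * ?K) * \<bar>s - t\<bar> powr 1" for s t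
    using \<open>a \<le> b\<close> by (simp add: right_diff_distrib[symmetric] abs_mult mult.assoc mult_left_mono)
  from periodic_response_DERIV_bound[OF assms(1,2) zero_less_one _ e this, of t] K \<open>a \<le> b\<close>
  have "\<bar>(b - a) * w t - a * (v t - w t)\<bar> \<le> 3 * ((b - a) * ?K) * a powr - 1" by simp
  also have "\<dots> = 9 * L * (b - a) / a * b powr - \<alpha>" using \<open>a > 0\<close> by (simp add: powr_minus_divide mult_ac)
  finally show ?thesis by (simp add: algebra_simps)
qed

section \<open>Sine series on the unit interval\<close>

definition freq :: "nat \<Rightarrow> real" where
  "freq k = real (Suc k) * pi"

definition sine_coeff :: "(real \<Rightarrow> real) \<Rightarrow> nat \<Rightarrow> real" where
  "sine_coeff q k = 2 * integral {0..1} (\<lambda>x. q x * sin (freq k * x))"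

lemma freq_pos: "freq k > 0" and freq_ge_1: "freq k \<ge> 1" and freq_nonzero [simp]: "freq k \<noteq> 0"
proof -
  have "1 * 3 \<le> real (Suc k) * pi" using pi_gt3 by (intro mult_mono) auto
  then show "freq k > 0" "freq k \<ge> 1" "freq k \<noteq> 0" by (simp_all add: freq_def)
qed

lemma sin_freq [simp]: "sin (freq k) = 0"
  unfolding freq_def by (rule sin_npi)

lemma integrable_on_unit_interval:
  fixes q :: "real \<Rightarrow> real"
  assumes "continuous_on {0..1} q"
  shows "q integrable_on {0..1}"
  using assms by (rule integrable_continuous_real)

lemma integral_sin_freq_sin_freq:
  "integral {0..1} (\<lambda>x. sin (freq j * x) * sin (freq k * x)) = (if j = k then 1/2 else 0)"
proof -
  have cos0: "((\<lambda>x. cos (of_int m * pi * x)) has_integral 0) {0..1}" if "m \<noteq> 0" for m :: int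
  proof -
    have "((\<lambda>x. cos (of_int m * pi * x)) has_integral
        sin (of_int m * pi * 1) / (of_int m * pi) - sin (of_int m * pi * 0) / (of_int m * pi)) {0..1}"
      using that
      by (intro fundamental_theorem_of_calculus)
        (auto intro!: derivative_eq_intros simp: has_real_derivative_iff_has_vector_derivative[symmetric])
    then show ?thesis by (simp add: mult.commute)
  qed
  have eq: "sin (freq j * x) * sin (freq k * x) =
      (cos (of_int (int j - int k) * pi * x) - cos (of_int (int j + int k + 2) * pi * x)) / 2" for x
    by (simp add: sin_times_sin freq_def algebra_simps)
  show ?thesis
  proof (cases "j = k")
    case True
    have "((\<lambda>x. (1 - cos (of_int (int j + int k + 2) * pi * x)) / 2) has_integral (1 - 0) / 2) {0..1}"
      using has_integral_const_real[of "1::real" 0 1]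
      by (intro has_integral_divide has_integral_diff cos0) auto
    with True show ?thesis unfolding eq by (intro integral_unique) simp
  next
    case False
    have "((\<lambda>x. (cos (of_int (int j - int k) * pi * x) - cos (of_int (int j + int k + 2) * pi * x)) / 2)
        has_integral (0 - 0) / 2) {0..1}"
      using False by (intro has_integral_divide has_integral_diff cos0) auto
    with False show ?thesis unfolding eq by (intro integral_unique) simp
  qed
qed

lemma sine_coeff_cong:
  "(\<And>x. x \<in> {0..1} \<Longrightarrow> p x = q x) \<Longrightarrow> sine_coeff p k = sine_coeff q k"
  unfolding sine_coeff_def using integral_cong[of "{0..1}"] by (metis (no_types, lifting))

lemma sine_coeff_add:
  assumes "continuous_on {0..1} p" "continuous_on {0..1} q"
  shows "sine_coeff (\<lambda>x. p x + q x) k = sine_coeff p k + sine_coeff q k"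
  unfolding sine_coeff_def distrib_right
  by (subst Henstock_Kurzweil_Integration.integral_add)
    (auto intro!: integrable_on_unit_interval continuous_intros assms)

lemma sine_coeff_cmult: "sine_coeff (\<lambda>x. c * q x) k = c * sine_coeff q k"
  by (simp add: sine_coeff_def mult.assoc)

lemma sine_coeff_diff:
  assumes "continuous_on {0..1} p" "continuous_on {0..1} q"
  shows "sine_coeff (\<lambda>x. p x - q x) k = sine_coeff p k - sine_coeff q k"
  using sine_coeff_add[OF assms(1), of "\<lambda>x. - 1 * q x" k] sine_coeff_cmult[of "-1" q k] assms(2)
  by (simp add: continuous_on_minus)

lemma integral_sine_poly_square:
  assumes "finite I"
  shows "integral {0..1} (\<lambda>x. (\<Sum>k\<in>I. c k * sin (freq k * x))\<^sup>2) = (\<Sum>k\<in>I. (c k)\<^sup>2) / 2"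
proof -
  have "integral {0..1} (\<lambda>x. (\<Sum>k\<in>I. c k * sin (freq k * x))\<^sup>2) =
      integral {0..1} (\<lambda>x. \<Sum>j\<in>I. \<Sum>k\<in>I. c j * c k * (sin (freq j * x) * sin (freq k * x)))"
    by (simp add: power2_eq_square sum_product mult_ac)
  also have "\<dots> = (\<Sum>j\<in>I. \<Sum>k\<in>I. integral {0..1} (\<lambda>x. c j * c k * (sin (freq j * x) * sin (freq k * x))))"
    using assms
    by (subst integral_sum; (intro sum.cong refl integral_sum)?)
      (auto intro!: integrable_on_unit_interval continuous_intros)
  also have "\<dots> = (\<Sum>j\<in>I. \<Sum>k\<in>I. if j = k then c j * c k / 2 else 0)"
    by (intro sum.cong refl) (simp add: integral_sin_freq_sin_freq)
  also have "\<dots> = (\<Sum>k\<in>I. (c k)\<^sup>2) / 2"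
    using assms by (simp add: sum_divide_distrib power2_eq_square)
  finally show ?thesis .
qed

text \<open>Expand the square in \<open>0 \<le> \<integral> (q - \<Sum> c\<^sub>k sin (freq k x))\<^sup>2\<close>. The factor \<open>2\<close> is due to the normalisation of
  \<open>sine_coeff\<close>, for which \<open>sin (freq k x)\<close> has coefficient \<open>1\<close> and squared norm \<open>1/2\<close>.\<close>

lemma sine_bessel:
  assumes q: "continuous_on {0..1} q" and "finite I"
  shows "(\<Sum>k\<in>I. (sine_coeff q k)\<^sup>2) \<le> 2 * integral {0..1} (\<lambda>x. (q x)\<^sup>2)"
proof -
  let ?c = "sine_coeff q"
  let ?P = "\<lambda>x. \<Sum>k\<in>I. ?c k * sin (freq k * x)"
  have P: "continuous_on {0..1} ?P" by (intro continuous_intros)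
  have "integral {0..1} (\<lambda>x. q x * ?P x) = (\<Sum>k\<in>I. integral {0..1} (\<lambda>x. ?c k * (q x * sin (freq k * x))))"
    unfolding sum_distrib_left using assms
    by (subst integral_sum[symmetric])
      (auto intro!: integrable_on_unit_interval continuous_intros simp: mult_ac)
  also have "\<dots> = (\<Sum>k\<in>I. (?c k)\<^sup>2) / 2"
    by (simp add: sum_divide_distrib power2_eq_square sine_coeff_def mult.assoc)
  finally have qP: "integral {0..1} (\<lambda>x. q x * ?P x) = (\<Sum>k\<in>I. (?c k)\<^sup>2) / 2" .
  have "0 \<le> integral {0..1} (\<lambda>x. (q x - ?P x)\<^sup>2)"
    by (intro integral_nonneg integrable_on_unit_interval continuous_intros q P) auto
  also have "(\<lambda>x. (q x - ?P x)\<^sup>2) = (\<lambda>x. ((q x)\<^sup>2 - 2 * (q x * ?P x)) + (?P x)\<^sup>2)"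
    by (auto simp: power2_eq_square algebra_simps)
  also have "integral {0..1} \<dots> =
      integral {0..1} (\<lambda>x. (q x)\<^sup>2) - 2 * integral {0..1} (\<lambda>x. q x * ?P x) + integral {0..1} (\<lambda>x. (?P x)\<^sup>2)"
    by (subst Henstock_Kurzweil_Integration.integral_add Henstock_Kurzweil_Integration.integral_diff;
        (subst Henstock_Kurzweil_Integration.integral_diff)?;
        (intro integrable_on_unit_interval continuous_intros q P)?) auto
  finally show ?thesis
    using qP integral_sine_poly_square[OF \<open>finite I\<close>, of ?c] by simp
qed

lemma uniform_limit_sine_series:
  assumes "summable P" "\<And>k. \<bar>c k\<bar> \<le> P k"
  shows "uniform_limit A (\<lambda>N x. \<Sum>k<N. c k * sin (freq k * x)) (\<lambda>x. \<Sum>k. c k * sin (freq k * x)) sequentially"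
proof (rule Weierstrass_m_test[OF _ assms(1)])
  fix k x
  have "\<bar>c k\<bar> * \<bar>sin (freq k * x)\<bar> \<le> \<bar>c k\<bar> * 1" by (intro mult_left_mono) auto
  then show "norm (c k * sin (freq k * x)) \<le> P k" using assms(2)[of k] by (simp add: abs_mult)
qed

lemma continuous_on_sine_series:
  assumes "summable P" "\<And>k. \<bar>c k\<bar> \<le> P k"
  shows "continuous_on A (\<lambda>x. \<Sum>k. c k * sin (freq k * x))"
  by (rule uniform_limit_theorem[OF _ uniform_limit_sine_series[OF assms]])
    (auto intro!: always_eventually continuous_intros)

lemma sine_coeff_sine_series:
  assumes "summable P" "\<And>k. \<bar>c k\<bar> \<le> P k"
  shows "sine_coeff (\<lambda>x. \<Sum>k. c k * sin (freq k * x)) j = c j"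
proof -
  let ?S = "\<lambda>x. \<Sum>k. c k * sin (freq k * x)"
  let ?P = "\<lambda>N x. \<Sum>k<N. c k * sin (freq k * x)"
  have ul: "uniform_limit {0..1} (\<lambda>N x. ?P N x * sin (freq j * x)) (\<lambda>x. ?S x * sin (freq j * x)) sequentially"
  proof (rule uniform_lim_mult[OF uniform_limit_sine_series[OF assms] uniform_limit_const])
    show "bounded (?S ` {0..1})"
      using compact_continuous_image[OF continuous_on_sine_series[OF assms], of "{0..1}"]
      by (auto intro: compact_imp_bounded)
    show "bounded ((\<lambda>x. sin (freq j * x)) ` {0..1})" by (auto intro!: boundedI[of _ 1])
  qed
  obtain I J where I: "\<And>N. ((\<lambda>x. ?P N x * sin (freq j * x)) has_integral I N) {0..1}"
    and J: "((\<lambda>x. ?S x * sin (freq j * x)) has_integral J) {0..1}" and IJ: "I \<longlonglongrightarrow> J"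
    by (rule uniform_limit_integral[OF ul]) (auto intro!: continuous_intros)
  have "I N = c j / 2" if "N > j" for N
  proof -
    have "I N = integral {0..1} (\<lambda>x. \<Sum>k<N. c k * (sin (freq k * x) * sin (freq j * x)))"
      using I[of N] by (simp add: integral_unique sum_distrib_right mult.assoc)
    also have "\<dots> = (\<Sum>k<N. integral {0..1} (\<lambda>x. c k * (sin (freq k * x) * sin (freq j * x))))"
      by (intro integral_sum) (auto intro!: integrable_on_unit_interval continuous_intros)
    also have "\<dots> = (\<Sum>k<N. if k = j then c k / 2 else 0)"
      by (intro sum.cong refl) (simp add: integral_sin_freq_sin_freq)
    also have "\<dots> = c j / 2" using that by (simp add: sum.delta)
    finally show ?thesis .
  qed
  then have "eventually (\<lambda>N. c j / 2 = I N) sequentially"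
    by (auto intro!: eventually_sequentiallyI[of "Suc j"])
  then have "I \<longlonglongrightarrow> c j / 2" by (rule tendsto_eventually[OF eventually_mono]) auto
  then have "J = c j / 2" using IJ LIMSEQ_unique by blast
  then show ?thesis using J by (simp add: sine_coeff_def integral_unique)
qed

lemma integral_sine_series_square_le:
  assumes "summable P" "\<And>k. \<bar>c k\<bar> \<le> P k" "\<And>N. (\<Sum>k<N. (c k)\<^sup>2) \<le> B"
  shows "integral {0..1} (\<lambda>x. (\<Sum>k. c k * sin (freq k * x))\<^sup>2) \<le> B / 2"
proof -
  let ?S = "\<lambda>x. \<Sum>k. c k * sin (freq k * x)"
  let ?P = "\<lambda>N x. \<Sum>k<N. c k * sin (freq k * x)"
  have b: "bounded (?S ` {0..1})"
    using compact_continuous_image[OF continuous_on_sine_series[OF assms(1,2)], of "{0..1}"]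
    by (auto intro: compact_imp_bounded)
  have ul: "uniform_limit {0..1} (\<lambda>N x. ?P N x * ?P N x) (\<lambda>x. ?S x * ?S x) sequentially"
    by (rule uniform_lim_mult[OF uniform_limit_sine_series[OF assms(1,2)] uniform_limit_sine_series[OF assms(1,2)] b b])
  obtain I J where I: "\<And>N. ((\<lambda>x. ?P N x * ?P N x) has_integral I N) {0..1}"
    and J: "((\<lambda>x. ?S x * ?S x) has_integral J) {0..1}" and IJ: "I \<longlonglongrightarrow> J"
    by (rule uniform_limit_integral[OF ul]) (auto intro!: continuous_intros)
  have "I N \<le> B / 2" for N
    using integral_sine_poly_square[of "{..<N}" c] integral_unique[OF I[of N]] assms(3)[of N]
    by (simp add: power2_eq_square)
  then have "J \<le> B / 2" using LIMSEQ_le_const2[OF IJ] by blast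
  then show ?thesis using integral_unique[OF J] by (simp add: power2_eq_square)
qed

text \<open>Multiplication by \<open>cos (\<pi> x)\<close> maps the span of the \<open>sin (freq k x)\<close> into itself, so \<open>r = q sin (\<pi> x)\<close> is
  orthogonal to all polynomials in \<open>cos (\<pi> x)\<close>. By the Weierstrass theorem, applied in the variable
  \<open>y = cos (\<pi> x)\<close>, these polynomials approximate \<open>r\<close> itself, and therefore \<open>\<integral> r\<^sup>2 = 0\<close>.\<close>

lemma sine_coeff_zero_imp_zero:
  assumes q: "continuous_on {0..1} q" and c: "\<And>k. sine_coeff q k = 0" and x: "x \<in> {0..1}"
  shows "q x = 0"
proof -
  define r where "r = (\<lambda>x. q x * sin (pi * x))"
  have r: "continuous_on {0..1} r" unfolding r_def by (intro continuous_intros q)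
  have mono: "integral {0..1} (\<lambda>x. q x * sin (freq k * x) * cos (pi * x) ^ j) = 0" for j k
  proof (induction j arbitrary: k)
    case 0
    then show ?case using c[of k] by (simp add: sine_coeff_def)
  next
    case (Suc j)
    have int: "(\<lambda>x. q x * sin (a * x) * cos (pi * x) ^ j) integrable_on {0..1}" for a
      by (intro integrable_on_unit_interval continuous_intros q)
    have eq: "q x * sin (freq k * x) * cos (pi * x) ^ Suc j =
        (q x * sin (freq (Suc k) * x) * cos (pi * x) ^ j + q x * sin ((freq k - pi) * x) * cos (pi * x) ^ j) / 2" for x
    proof -
      have "sin (freq k * x) * cos (pi * x) = (sin (freq (Suc k) * x) + sin ((freq k - pi) * x)) / 2"
      proof -
        have "freq k * x + pi * x = freq (Suc k) * x" "freq k * x - pi * x = (freq k - pi) * x"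
          by (simp_all add: freq_def algebra_simps)
        then show ?thesis by (simp only: sin_times_cos)
      qed
      then have "q x * (sin (freq k * x) * cos (pi * x)) * cos (pi * x) ^ j =
          q x * ((sin (freq (Suc k) * x) + sin ((freq k - pi) * x)) / 2) * cos (pi * x) ^ j" by simp
      then show ?thesis by (simp add: algebra_simps)
    qed
    have zero: "integral {0..1} (\<lambda>x. q x * sin ((freq k - pi) * x) * cos (pi * x) ^ j) = 0"
    proof (cases k)
      case 0
      then show ?thesis by (simp add: freq_def)
    next
      case (Suc m)
      then have "freq k - pi = freq m" by (simp add: freq_def algebra_simps)
      then show ?thesis using Suc.IH[of m] by simp
    qed
    show ?case
      unfolding eq integral_divide
      by (subst Henstock_Kurzweil_Integration.integral_add[OF int int]) (simp add: zero Suc.IH[of "Suc k"])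
  qed
  have rcos: "integral {0..1} (\<lambda>x. r x * cos (pi * x) ^ j) = 0" for j
    using mono[of 0 j] by (simp add: r_def freq_def)
  have rpoly: "integral {0..1} (\<lambda>x. r x * p (cos (pi * x))) = 0" if "real_polynomial_function p" for p
  proof -
    obtain a n where p: "p = (\<lambda>x. \<Sum>i\<le>n. a i * x ^ i)"
      using \<open>real_polynomial_function p\<close> by (auto simp: real_polynomial_function_iff_sum)
    have "integral {0..1} (\<lambda>x. r x * p (cos (pi * x))) =
        integral {0..1} (\<lambda>x. \<Sum>i\<le>n. a i * (r x * cos (pi * x) ^ i))"
      by (simp add: p sum_distrib_left mult_ac)
    also have "\<dots> = (\<Sum>i\<le>n. integral {0..1} (\<lambda>x. a i * (r x * cos (pi * x) ^ i)))"
      by (intro integral_sum) (auto intro!: integrable_on_unit_interval continuous_intros r)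
    finally show ?thesis by (simp add: rcos)
  qed
  let ?Y = "\<lambda>y. r (arccos y / pi)"
  have Y: "continuous_on {-1..1} ?Y"
    by (rule continuous_on_compose2[OF r])
      (auto intro!: continuous_intros simp: arccos_lbound arccos_ubound divide_le_eq_1)
  have rY: "r x = ?Y (cos (pi * x))" if "x \<in> {0..1}" for x
  proof -
    have "pi * x \<le> pi * 1" using that by (intro mult_left_mono) auto
    then show ?thesis using that by (simp add: arccos_cos)
  qed
  let ?K = "integral {0..1} (\<lambda>x. \<bar>r x\<bar>)"
  have K: "?K \<ge> 0" by (intro integral_nonneg integrable_on_unit_interval continuous_intros r) auto
  have le: "integral {0..1} (\<lambda>x. r x * r x) \<le> e * ?K" if "e > 0" for e
  proof -
    obtain p where p: "real_polynomial_function p" "\<And>y. y \<in> {-1..1} \<Longrightarrow> \<bar>?Y y - p y\<bar> < e"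
      using Stone_Weierstrass_real_polynomial_function[OF compact_Icc Y \<open>e > 0\<close>] by blast
    have pc: "continuous_on S p" for S
      using p(1) by (intro continuous_on_polymonial_function) (simp add: real_polynomial_function_eq)
    have pcc: "continuous_on {0..1} (\<lambda>x. p (cos (pi * x)))"
      by (rule continuous_on_compose2[OF pc[of UNIV]]) (auto intro!: continuous_intros)
    have "integral {0..1} (\<lambda>x. r x * r x) =
        integral {0..1} (\<lambda>x. r x * r x) - integral {0..1} (\<lambda>x. r x * p (cos (pi * x)))"
      using rpoly[OF p(1)] by simp
    also have "\<dots> = integral {0..1} (\<lambda>x. r x * (r x - p (cos (pi * x))))"
      unfolding right_diff_distrib
      by (subst Henstock_Kurzweil_Integration.integral_diff)
        (auto intro!: integrable_on_unit_interval continuous_intros r pcc)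
    also have "\<dots> \<le> integral {0..1} (\<lambda>x. e * \<bar>r x\<bar>)"
    proof (intro integral_le integrable_on_unit_interval continuous_intros r pcc)
      fix x :: real assume x: "x \<in> {0..1}"
      have "\<bar>r x * (r x - p (cos (pi * x)))\<bar> \<le> \<bar>r x\<bar> * e"
        using p(2)[of "cos (pi * x)"] rY[OF x] by (simp add: abs_mult mult_left_mono)
      then show "r x * (r x - p (cos (pi * x))) \<le> e * \<bar>r x\<bar>" by (simp add: mult.commute)
    qed
    finally show ?thesis by simp
  qed
  have "integral {0..1} (\<lambda>x. r x * r x) \<le> 0 + e" if "e > 0" for e
  proof -
    have "e / (?K + 1) * ?K \<le> e" using K that by (simp add: field_simps)
    then show ?thesis using le[of "e / (?K + 1)"] K that by simp
  qed
  then have "integral {0..1} (\<lambda>x. r x * r x) \<le> 0" by (rule field_le_epsilon)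
  moreover have rr: "continuous_on {0..1} (\<lambda>x. r x * r x)" by (intro continuous_intros r)
  then have "integral {0..1} (\<lambda>x. r x * r x) \<ge> 0"
    by (intro integral_nonneg integrable_on_unit_interval) auto
  ultimately have "\<forall>x\<in>{0..1}. r x * r x = 0"
    using integral_eq_0_iff[OF rr] by simp
  then have q0: "q x = 0" if "x \<in> {0<..<1}" for x
    using that sin_gt_zero[of "pi * x"] by (auto simp: r_def dest: bspec[of _ _ x])
  have "closure {0<..<1::real} = {0..1}" by simp
  then show ?thesis
    using continuous_constant_on_closure[of "{0<..<1}" q 0 x] q q0 x by simp
qed

lemma sine_coeff_eq_imp_eq:
  assumes "continuous_on {0..1} p" "continuous_on {0..1} q" "\<And>k. sine_coeff p k = sine_coeff q k"
    and "x \<in> {0..1}"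
  shows "p x = q x"
  using sine_coeff_zero_imp_zero[of "\<lambda>x. p x - q x" x] assms
  by (simp add: sine_coeff_diff continuous_on_diff)

lemma continuous_on_slice:
  assumes "continuous_on (UNIV \<times> S) (\<lambda>(t, x). h t x)"
  shows "continuous_on S (h t)"
proof -
  have "continuous_on S (\<lambda>x. (t, x))" by (intro continuous_intros)
  from continuous_on_compose2[OF assms this] show ?thesis by auto
qed

lemma continuous_on_separated_series:
  fixes a \<phi> :: "nat \<Rightarrow> real \<Rightarrow> real"
  assumes "summable P" "\<And>k t. \<bar>a k t\<bar> \<le> P k" "\<And>k. continuous_on UNIV (a k)"
    and "\<And>k x. \<bar>\<phi> k x\<bar> \<le> 1" "\<And>k. continuous_on UNIV (\<phi> k)"
  shows "continuous_on S (\<lambda>(t, x). \<Sum>k. a k t * \<phi> k x)"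
proof (rule uniform_limit_theorem)
  have "uniform_limit S (\<lambda>N z. \<Sum>k<N. a k (fst z) * \<phi> k (snd z)) (\<lambda>z. \<Sum>k. a k (fst z) * \<phi> k (snd z)) sequentially"
  proof (rule Weierstrass_m_test[OF _ assms(1)])
    fix k and z :: "real \<times> real"
    have "\<bar>a k (fst z)\<bar> * \<bar>\<phi> k (snd z)\<bar> \<le> \<bar>a k (fst z)\<bar> * 1" by (intro mult_left_mono assms) auto
    then show "norm (a k (fst z) * \<phi> k (snd z)) \<le> P k" using assms(2)[of k "fst z"] by (simp add: abs_mult)
  qed
  then show "uniform_limit S (\<lambda>N z. \<Sum>k<N. a k (fst z) * \<phi> k (snd z)) (\<lambda>(t, x). \<Sum>k. a k t * \<phi> k x) sequentially"
    by (simp add: case_prod_unfold)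
  show "\<forall>\<^sub>F N in sequentially. continuous_on S (\<lambda>z. \<Sum>k<N. a k (fst z) * \<phi> k (snd z))"
    by (intro always_eventually allI continuous_intros
        continuous_on_compose2[OF assms(3)] continuous_on_compose2[OF assms(5)]) auto
qed simp

lemma sine_series_DERIV:
  assumes "summable P" "\<And>k. \<bar>c k * freq k\<bar> \<le> P k"
  shows "((\<lambda>x. \<Sum>k. c k * sin (freq k * x)) has_real_derivative (\<Sum>k. (c k * freq k) * cos (freq k * x))) (at x)"
proof (rule has_field_derivative_series'(2)[where S = UNIV and ?x0.0 = 0 and f = "\<lambda>k x. c k * sin (freq k * x)"
        and f' = "\<lambda>k x. (c k * freq k) * cos (freq k * x)"])
  show "((\<lambda>x. c n * sin (freq n * x)) has_real_derivative (c n * freq n) * cos (freq n * x)) (at x within UNIV)"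
    for n x by (auto intro!: derivative_eq_intros)
  show "uniformly_convergent_on UNIV (\<lambda>N x. \<Sum>k<N. (c k * freq k) * cos (freq k * x))"
  proof (rule Weierstrass_m_test'[OF _ assms(1)])
    fix k x
    have "\<bar>c k * freq k\<bar> * \<bar>cos (freq k * x)\<bar> \<le> \<bar>c k * freq k\<bar> * 1" by (intro mult_left_mono) auto
    then show "norm ((c k * freq k) * cos (freq k * x)) \<le> P k" using assms(2)[of k] by (simp add: abs_mult)
  qed
qed auto

lemma cosine_series_DERIV:
  assumes "summable P" "\<And>k. \<bar>c k * freq k\<bar> \<le> P k"
  shows "((\<lambda>x. \<Sum>k. c k * cos (freq k * x)) has_real_derivative (\<Sum>k. (- c k * freq k) * sin (freq k * x))) (at x)"
proof (rule has_field_derivative_series'(2)[where S = UNIV and ?x0.0 = 0 and f = "\<lambda>k x. c k * cos (freq k * x)"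
        and f' = "\<lambda>k x. (- c k * freq k) * sin (freq k * x)"])
  show "((\<lambda>x. c n * cos (freq n * x)) has_real_derivative (- c n * freq n) * sin (freq n * x)) (at x within UNIV)"
    for n x by (auto intro!: derivative_eq_intros)
  show "uniformly_convergent_on UNIV (\<lambda>N x. \<Sum>k<N. (- c k * freq k) * sin (freq k * x))"
  proof (rule Weierstrass_m_test'[OF _ assms(1)])
    fix k x
    have "\<bar>c k * freq k\<bar> * \<bar>sin (freq k * x)\<bar> \<le> \<bar>c k * freq k\<bar> * 1" by (intro mult_left_mono) auto
    then show "norm ((- c k * freq k) * sin (freq k * x)) \<le> P k" using assms(2)[of k] by (simp add: abs_mult)
  qed
  show "summable (\<lambda>k. c k * cos (freq k * 0))"
  proof (rule summable_comparison_test[OF _ assms(1)], intro exI[of _ 0] allI impI)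
    fix k
    have "\<bar>c k\<bar> * 1 \<le> \<bar>c k\<bar> * \<bar>freq k\<bar>" using freq_ge_1[of k] by (intro mult_left_mono) auto
    then show "norm (c k * cos (freq k * 0)) \<le> P k" using assms(2)[of k] by (simp add: abs_mult)
  qed
qed auto

lemma sine_coeff_bound:
  assumes "continuous_on {0..1} q" "\<And>x. x \<in> {0..1} \<Longrightarrow> \<bar>q x\<bar> \<le> B"
  shows "\<bar>sine_coeff q k\<bar> \<le> 2 * B"
proof -
  have "norm (integral {0..1} (\<lambda>x. q x * sin (freq k * x))) \<le> B * (1 - 0)"
  proof (rule integral_bound)
    fix x :: real assume x: "x \<in> {0..1}"
    have "\<bar>q x\<bar> * \<bar>sin (freq k * x)\<bar> \<le> \<bar>q x\<bar> * 1" by (intro mult_left_mono) auto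
    then show "norm (q x * sin (freq k * x)) \<le> B" using assms(2)[OF x] by (simp add: abs_mult)
  qed (auto intro!: continuous_intros assms)
  then show ?thesis by (simp add: sine_coeff_def)
qed

section \<open>Second derivatives and time derivatives in terms of sine coefficients\<close>

lemma sine_coeff_time_DERIV:
  assumes der: "\<And>t x. x \<in> {0..1} \<Longrightarrow> ((\<lambda>s. v s x) has_real_derivative vt t x) (at t)"
    and cont: "continuous_on (UNIV \<times> {0..1}) (\<lambda>(t, x). vt t x)"
    and slice: "\<And>t. continuous_on {0..1} (v t)"
  shows "((\<lambda>t. sine_coeff (v t) k) has_real_derivative sine_coeff (vt t) k) (at t)"
proof -
  have "((\<lambda>t. integral (cbox 0 1) (\<lambda>x. v t x * sin (freq k * x))) has_field_derivative
      integral (cbox 0 1) (\<lambda>x. vt t x * sin (freq k * x))) (at t within UNIV)"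
  proof (rule leibniz_rule_field_derivative)
    show "((\<lambda>t. v t x * sin (freq k * x)) has_field_derivative vt t x * sin (freq k * x)) (at t within UNIV)"
      if "x \<in> cbox 0 1" for t x
      by (rule DERIV_cmult_right) (use der[of x t] that in simp)
    show "(\<lambda>x. v t x * sin (freq k * x)) integrable_on cbox 0 1" for t
      using slice by (auto intro!: integrable_continuous_real continuous_intros)
    have "continuous_on (UNIV \<times> cbox 0 1) (\<lambda>z. (case z of (t, x) \<Rightarrow> vt t x) * sin (freq k * snd z))"
      using cont by (intro continuous_intros) auto
    then show "continuous_on (UNIV \<times> cbox 0 1) (\<lambda>(t, x). vt t x * sin (freq k * x))"
      by (simp add: case_prod_unfold)
  qed auto
  from DERIV_cmult[OF this, of 2] show ?thesis by (simp add: sine_coeff_def)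
qed

text \<open>Green's identity. The first derivative \<open>w'\<close> is given in the interior only, but a bounded second
  derivative makes it extend continuously: it differs from the antiderivative of \<open>q\<close> by a constant.\<close>

lemma sine_coeff_second_derivative:
  assumes w: "continuous_on {0..1} w" and q: "continuous_on {0..1} q"
    and d1: "\<And>x. x \<in> {0<..<1} \<Longrightarrow> (w has_real_derivative w' x) (at x)"
    and d2: "\<And>x. x \<in> {0<..<1} \<Longrightarrow> (w' has_real_derivative q x) (at x)"
    and bc: "w 0 = 0" "w 1 = 0"
  shows "sine_coeff q k = - (freq k ^ 2) * sine_coeff w k"
proof -
  let ?Q = "\<lambda>x. integral {0..x} q"
  have Qd: "(?Q has_real_derivative q x) (at x)" if "x \<in> {0<..<1}" for x
    using integral_has_real_derivative[OF q, of x] that at_within_Icc_at[of 0 x 1] by simp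
  have Qc: "continuous_on {0..1} ?Q"
    by (rule indefinite_integral_continuous_1[OF integrable_on_unit_interval[OF q]])
  have "((\<lambda>x. w' x - ?Q x) has_real_derivative 0) (at x within {0<..<1})" if "x \<in> {0<..<1}" for x
    using DERIV_diff[OF d2[OF that] Qd[OF that]] by (simp add: DERIV_subset[of _ _ _ UNIV])
  then obtain c where c: "\<And>x. x \<in> {0<..<1} \<Longrightarrow> w' x - ?Q x = c"
    using has_field_derivative_zero_constant[of "{0<..<1::real}" "\<lambda>x. w' x - ?Q x"] by auto
  have w': "w' x = ?Q x + c" if "x \<in> {0<..<1}" for x using c[OF that] by simp
  let ?\<kappa> = "freq k"
  \<comment> \<open>the boundary terms vanish because the sine and \<open>w\<close> do\<close>
  let ?\<Phi> = "\<lambda>x. (?Q x + c) * sin (?\<kappa> * x) - w x * (?\<kappa> * cos (?\<kappa> * x))"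
  have "((\<lambda>x. q x * sin (?\<kappa> * x) + ?\<kappa> ^ 2 * (w x * sin (?\<kappa> * x))) has_integral ?\<Phi> 1 - ?\<Phi> 0) {0..1}"
  proof (rule fundamental_theorem_of_calculus_interior)
    show "continuous_on {0..1} ?\<Phi>" by (intro continuous_intros Qc w)
    fix x :: real assume x: "x \<in> {0<..<1}"
    have s: "((\<lambda>x. sin (?\<kappa> * x)) has_real_derivative ?\<kappa> * cos (?\<kappa> * x)) (at x)"
      "((\<lambda>x. ?\<kappa> * cos (?\<kappa> * x)) has_real_derivative (- (?\<kappa> ^ 2) * sin (?\<kappa> * x))) (at x)"
      by (auto intro!: derivative_eq_intros simp: power2_eq_square)
    have Q': "((\<lambda>x. ?Q x + c) has_real_derivative q x) (at x)"
      using DERIV_add[OF Qd[OF x] DERIV_const[of c]] by simp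
    have "(?\<Phi> has_real_derivative q x * sin (?\<kappa> * x) + ?\<kappa> ^ 2 * (w x * sin (?\<kappa> * x))) (at x)"
      using DERIV_diff[OF DERIV_mult[OF Q' s(1)] DERIV_mult[OF d1[OF x] s(2)]] w'[OF x]
      by (simp add: algebra_simps)
    then show "(?\<Phi> has_vector_derivative q x * sin (?\<kappa> * x) + ?\<kappa> ^ 2 * (w x * sin (?\<kappa> * x))) (at x)"
      by (simp add: has_real_derivative_iff_has_vector_derivative)
  qed simp
  then have "integral {0..1} (\<lambda>x. q x * sin (?\<kappa> * x) + ?\<kappa> ^ 2 * (w x * sin (?\<kappa> * x))) = 0"
    using bc by (simp add: integral_unique)
  moreover have "integral {0..1} (\<lambda>x. q x * sin (?\<kappa> * x) + ?\<kappa> ^ 2 * (w x * sin (?\<kappa> * x))) =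
      integral {0..1} (\<lambda>x. q x * sin (?\<kappa> * x)) + integral {0..1} (\<lambda>x. ?\<kappa> ^ 2 * (w x * sin (?\<kappa> * x)))"
    by (intro Henstock_Kurzweil_Integration.integral_add integrable_on_unit_interval continuous_intros q w)
  ultimately have "integral {0..1} (\<lambda>x. q x * sin (?\<kappa> * x)) = - (?\<kappa> ^ 2) * integral {0..1} (\<lambda>x. w x * sin (?\<kappa> * x))"
    unfolding integral_mult_right by linarith
  then show ?thesis by (simp only: sine_coeff_def mult.left_commute)
qed

text \<open>Let \<open>W\<close> solve \<open>W'' = q\<close> with \<open>W 0 = W 1 = 0\<close>. Green's identity shows that \<open>W\<close> and \<open>p\<close> have the same sine
  coefficients, so they are equal by completeness.\<close>

lemma weak_second_derivative_imp_strong: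
  assumes p: "continuous_on {0..1} p" and q: "continuous_on {0..1} q"
    and coeff: "\<And>k. sine_coeff q k = - (freq k ^ 2) * sine_coeff p k"
  obtains p' where "\<And>x. x \<in> {0<..<1} \<Longrightarrow> (p has_real_derivative p' x) (at x)"
    "\<And>x. x \<in> {0<..<1} \<Longrightarrow> (p' has_real_derivative q x) (at x)" "p 0 = 0" "p 1 = 0"
proof -
  let ?Q = "\<lambda>x. integral {0..x} q"
  let ?QQ = "\<lambda>x. integral {0..x} ?Q"
  have Qc: "continuous_on {0..1} ?Q"
    by (rule indefinite_integral_continuous_1[OF integrable_on_unit_interval[OF q]])
  have QQc: "continuous_on {0..1} ?QQ"
    by (rule indefinite_integral_continuous_1[OF integrable_on_unit_interval[OF Qc]])
  define W where "W x = ?QQ x - ?QQ 1 * x" for x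
  define W' where "W' x = ?Q x - ?QQ 1" for x
  have Wc: "continuous_on {0..1} W" unfolding W_def by (intro continuous_intros QQc)
  have W1: "(W has_real_derivative W' x) (at x)" if "x \<in> {0<..<1}" for x
  proof -
    have "(?QQ has_real_derivative ?Q x) (at x)"
      using integral_has_real_derivative[OF Qc, of x] that at_within_Icc_at[of 0 x 1] by simp
    then show ?thesis unfolding W_def W'_def by (auto intro!: derivative_eq_intros)
  qed
  have W2: "(W' has_real_derivative q x) (at x)" if "x \<in> {0<..<1}" for x
  proof -
    have "(?Q has_real_derivative q x) (at x)"
      using integral_has_real_derivative[OF q, of x] that at_within_Icc_at[of 0 x 1] by simp
    then show ?thesis unfolding W'_def by (auto intro!: derivative_eq_intros)
  qed
  have W0: "W 0 = 0" "W 1 = 0" by (simp_all add: W_def)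
  have "sine_coeff p k = sine_coeff W k" for k
    using sine_coeff_second_derivative[OF Wc q W1 W2 W0, of k] coeff[of k] by simp
  then have eq: "p x = W x" if "x \<in> {0..1}" for x
    using sine_coeff_eq_imp_eq[OF p Wc _ that] by blast
  show thesis
  proof (rule that[of W'])
    show "(p has_real_derivative W' x) (at x)" if x: "x \<in> {0<..<1}" for x
      by (rule has_field_derivative_transform_within_open[OF W1[OF x], of "{0<..<1}"]) (use x eq in auto)
    show "p 0 = 0" "p 1 = 0" using eq[of 0] eq[of 1] W0 by simp_all
  qed (rule W2)
qed

section \<open>Logarithmic growth of sine partial sums\<close>

text \<open>Concavity of the sine on \<open>[0, \<pi>]\<close>.\<close>

lemma sin_half_pi_ge:
  assumes "0 \<le> w" "w \<le> 1"
  shows "w \<le> sin (pi * w / 2)"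
proof -
  have "concave_on {0..pi} sin"
    by (rule f''_le0_imp_concave[where f' = cos and f'' = "\<lambda>x. - sin x"])
      (auto intro!: derivative_eq_intros sin_ge_zero)
  from concave_onD[OF this, of w 0 "pi / 2"] assms show ?thesis by (simp add: mult.commute)
qed

text \<open>The Dirichlet kernel for cosines; partial sums of sine series are integrals against
  \<open>cosine_kernel N (x - y) - cosine_kernel N (x + y)\<close>.\<close>

definition cosine_kernel :: "nat \<Rightarrow> real \<Rightarrow> real" where
  "cosine_kernel N z = (\<Sum>k<N. cos (freq k * z))"

text \<open>A smooth stand-in for \<open>min N (1 / \<bar>z\<bar>)\<close> whose antiderivative is the inverse hyperbolic sine; its
  integral is what grows logarithmically.\<close>

definition kernel_majorant :: "nat \<Rightarrow> real \<Rightarrow> real" where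
  "kernel_majorant N z = 2 * (real N / sqrt ((real N * z)\<^sup>2 + 1))"

lemma cosine_kernel_minus: "cosine_kernel N (- z) = cosine_kernel N z"
  by (simp add: cosine_kernel_def)

lemma cosine_kernel_reflect: "cosine_kernel N (2 - z) = cosine_kernel N z"
proof -
  have "cos (freq k * (2 - z)) = cos (freq k * z)" for k
    using cos_diff[of "real (2 * Suc k) * pi" "freq k * z"] 
    by (simp only: cos_npi sin_npi) (simp add: freq_def algebra_simps)
  then show ?thesis by (simp add: cosine_kernel_def)
qed

lemma kernel_majorant_minus: "kernel_majorant N (- z) = kernel_majorant N z"
  by (simp add: kernel_majorant_def)

lemma kernel_majorant_nonneg: "kernel_majorant N z \<ge> 0"
  by (simp add: kernel_majorant_def)

text \<open>The kernel is trivially at most \<open>N\<close>, and at most \<open>1 / z\<close> because \<open>2 sin (\<pi> z / 2)\<close> times the sum telescopes.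
  The squares of the two bounds add up to the claim.\<close>

lemma cosine_kernel_le_of_nonneg:
  assumes "0 \<le> z" "z \<le> 1"
  shows "\<bar>cosine_kernel N z\<bar> \<le> kernel_majorant N z"
proof -
  let ?D = "cosine_kernel N z"
  have N: "\<bar>?D\<bar> \<le> real N"
    using sum_norm_le[of "{..<N}" "\<lambda>k. cos (freq k * z)" "\<lambda>_. 1"] by (simp add: cosine_kernel_def)
  have "2 * sin (pi * z / 2) * ?D = (\<Sum>k<N. sin ((real (Suc k) + 1/2) * pi * z) - sin ((real k + 1/2) * pi * z))"
    unfolding cosine_kernel_def sum_distrib_left
  proof (intro sum.cong refl)
    fix k
    have "((real (Suc k) + 1/2) * pi * z - (real k + 1/2) * pi * z) / 2 = pi * z / 2"
      "((real (Suc k) + 1/2) * pi * z + (real k + 1/2) * pi * z) / 2 = freq k * z"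
      by (simp_all add: freq_def field_simps)
    then show "2 * sin (pi * z / 2) * cos (freq k * z) =
        sin ((real (Suc k) + 1/2) * pi * z) - sin ((real k + 1/2) * pi * z)"
      by (simp only: sin_diff_sin)
  qed
  also have "\<dots> = sin ((real N + 1/2) * pi * z) - sin ((real 0 + 1/2) * pi * z)"
    by (rule sum_lessThan_telescope)
  also have "\<bar>\<dots>\<bar> \<le> 1 + 1" by (intro abs_triangle_ineq4[THEN order_trans] add_mono) auto
  finally have "\<bar>sin (pi * z / 2)\<bar> * \<bar>?D\<bar> \<le> 1" by (simp add: abs_mult)
  moreover have "z * \<bar>?D\<bar> \<le> \<bar>sin (pi * z / 2)\<bar> * \<bar>?D\<bar>"
    using sin_half_pi_ge[OF assms] by (intro mult_right_mono) auto
  ultimately have z: "z * \<bar>?D\<bar> \<le> 1" by linarith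
  have "?D\<^sup>2 * ((real N * z)\<^sup>2 + 1) = (real N)\<^sup>2 * (z * \<bar>?D\<bar>)\<^sup>2 + \<bar>?D\<bar>\<^sup>2"
    by (simp add: power2_eq_square algebra_simps)
  also have "\<dots> \<le> (real N)\<^sup>2 * 1\<^sup>2 + (real N)\<^sup>2"
    using z N assms by (intro add_mono mult_left_mono power_mono) auto
  also have "\<dots> \<le> (2 * real N)\<^sup>2" by (simp add: power2_eq_square)
  finally have "(\<bar>?D\<bar> * sqrt ((real N * z)\<^sup>2 + 1))\<^sup>2 \<le> (2 * real N)\<^sup>2"
    by (simp add: power_mult_distrib add_nonneg_nonneg)
  then have "\<bar>?D\<bar> * sqrt ((real N * z)\<^sup>2 + 1) \<le> 2 * real N" by (rule power2_le_imp_le) simp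
  moreover have "sqrt ((real N * z)\<^sup>2 + 1) > 0" by (simp add: add_nonneg_pos)
  ultimately show ?thesis by (simp add: kernel_majorant_def pos_le_divide_eq)
qed

lemma cosine_kernel_le:
  assumes "\<bar>z\<bar> \<le> 1"
  shows "\<bar>cosine_kernel N z\<bar> \<le> kernel_majorant N z"
  using cosine_kernel_le_of_nonneg[of z N] cosine_kernel_le_of_nonneg[of "- z" N] assms
  by (cases "z \<ge> 0") (auto simp: cosine_kernel_minus kernel_majorant_minus)

text \<open>The kernel has period \<open>2\<close>, so it is also large near \<open>z = 2\<close>.\<close>

lemma cosine_kernel_le_period:
  assumes "0 \<le> z" "z \<le> 2"
  shows "\<bar>cosine_kernel N z\<bar> \<le> kernel_majorant N z + kernel_majorant N (2 - z)"
  using cosine_kernel_le[of z N] cosine_kernel_le[of "2 - z" N] assms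
    kernel_majorant_nonneg[of N z] kernel_majorant_nonneg[of N "2 - z"]
  by (cases "z \<le> 1") (auto simp: cosine_kernel_reflect)

lemma arsinh_real_mono: "x \<le> y \<Longrightarrow> arsinh x \<le> arsinh (y::real)"
  by (metis arsinh_real_strict_mono order_le_less)

lemma has_integral_kernel_majorant:
  assumes "c = 1 \<or> c = - 1"
  shows "((\<lambda>y. kernel_majorant N (b + c * y)) has_integral
    2 * c * (arsinh (real N * (b + c)) - arsinh (real N * b))) {0..1}"
proof -
  have "((\<lambda>y. 2 * c * arsinh (real N * (b + c * y))) has_real_derivative kernel_majorant N (b + c * y))
    (at y within {0..1})" for y
  proof -
    have "((\<lambda>y. real N * (b + c * y)) has_real_derivative real N * c) (at y within {0..1})"
      by (auto intro!: derivative_eq_intros)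
    from DERIV_cmult[OF DERIV_chain2[OF arsinh_real_has_field_derivative this], of "2 * c"]
    show ?thesis using assms by (auto simp: kernel_majorant_def)
  qed
  then have "((\<lambda>y. kernel_majorant N (b + c * y)) has_integral
      2 * c * arsinh (real N * (b + c * 1)) - 2 * c * arsinh (real N * (b + c * 0))) {0..1}"
    by (intro fundamental_theorem_of_calculus)
      (auto simp: has_real_derivative_iff_has_vector_derivative[symmetric])
  then show ?thesis by (simp add: right_diff_distrib)
qed

text \<open>The Lebesgue constants of the sine system. The integrals of the three majorants combine to
  \<open>2 arsinh (N (x + 1)) + 2 arsinh (N (2 - x))\<close>, the remaining terms cancel.\<close>

lemma sine_partial_sum_bound:
  assumes q: "continuous_on {0..1} q" and B: "\<And>y. y \<in> {0..1} \<Longrightarrow> \<bar>q y\<bar> \<le> B" and x: "x \<in> {0..1}"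
  shows "\<bar>\<Sum>k<N. sine_coeff q k * sin (freq k * x)\<bar> \<le> 4 * arsinh (2 * real N) * B"
proof -
  have B0: "B \<ge> 0" using B[of 0] by simp
  let ?D = "cosine_kernel N" and ?m = "kernel_majorant N"
  let ?A = "\<lambda>w. arsinh (real N * w)"
  let ?m3 = "\<lambda>y. ?m (x + - 1 * y) + ?m (x + 1 * y) + ?m ((2 - x) + - 1 * y)"
  let ?I = "2 * - 1 * (?A (x + - 1) - ?A x) + 2 * 1 * (?A (x + 1) - ?A x)
    + 2 * - 1 * (?A ((2 - x) + - 1) - ?A (2 - x))"
  have kern: "(\<Sum>k<N. sin (freq k * y) * (2 * sin (freq k * x))) = ?D (x - y) - ?D (x + y)" for y
    unfolding cosine_kernel_def sum_subtractf[symmetric]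
  proof (intro sum.cong refl)
    fix k
    have "freq k * x - freq k * y = freq k * (x - y)" "freq k * x + freq k * y = freq k * (x + y)"
      by (simp_all add: algebra_simps)
    then have "2 * (sin (freq k * x) * sin (freq k * y)) = cos (freq k * (x - y)) - cos (freq k * (x + y))"
      unfolding sin_times_sin by simp
    moreover have "sin (freq k * y) * (2 * sin (freq k * x)) = 2 * (sin (freq k * x) * sin (freq k * y))"
      by (simp only: mult_ac)
    ultimately show "sin (freq k * y) * (2 * sin (freq k * x)) =
        cos (freq k * (x - y)) - cos (freq k * (x + y))" by simp
  qed
  have Dc: "continuous_on {0..1} (\<lambda>y. ?D (x - y) - ?D (x + y))"
    unfolding cosine_kernel_def by (intro continuous_intros)
  have "(\<Sum>k<N. sine_coeff q k * sin (freq k * x)) =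
      (\<Sum>k<N. integral {0..1} (\<lambda>y. q y * (sin (freq k * y) * (2 * sin (freq k * x)))))"
  proof (intro sum.cong refl)
    fix k
    have "integral {0..1} (\<lambda>y. q y * (sin (freq k * y) * (2 * sin (freq k * x)))) =
        integral {0..1} (\<lambda>y. q y * sin (freq k * y) * (2 * sin (freq k * x)))"
      by (simp only: mult.assoc)
    then show "sine_coeff q k * sin (freq k * x) =
        integral {0..1} (\<lambda>y. q y * (sin (freq k * y) * (2 * sin (freq k * x))))"
      by (simp add: sine_coeff_def)
  qed
  also have "\<dots> = integral {0..1} (\<lambda>y. q y * (?D (x - y) - ?D (x + y)))"
    unfolding kern[symmetric] sum_distrib_left
    by (intro integral_sum[symmetric]) (auto intro!: integrable_on_unit_interval continuous_intros q)
  finally have eq: "(\<Sum>k<N. sine_coeff q k * sin (freq k * x)) =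
      integral {0..1} (\<lambda>y. q y * (?D (x - y) - ?D (x + y)))" .
  have I: "((\<lambda>y. B * ?m3 y) has_integral B * ?I) {0..1}"
    by (intro has_integral_mult_right has_integral_add has_integral_kernel_majorant) auto
  have "norm (integral {0..1} (\<lambda>y. q y * (?D (x - y) - ?D (x + y)))) \<le> integral {0..1} (\<lambda>y. B * ?m3 y)"
  proof (rule integral_norm_bound_integral)
    show "(\<lambda>y. q y * (?D (x - y) - ?D (x + y))) integrable_on {0..1}"
      by (intro integrable_on_unit_interval continuous_on_mult q Dc)
    show "(\<lambda>y. B * ?m3 y) integrable_on {0..1}" using I by blast
    fix y :: real assume y: "y \<in> {0..1}"
    have "\<bar>?D (x - y)\<bar> \<le> ?m (x - y)" using x y by (intro cosine_kernel_le) auto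
    moreover have "\<bar>?D (x + y)\<bar> \<le> ?m (x + y) + ?m (2 - (x + y))"
      using x y by (intro cosine_kernel_le_period) auto
    ultimately have "\<bar>?D (x - y) - ?D (x + y)\<bar> \<le> ?m3 y" by (simp add: algebra_simps)
    then have "\<bar>q y\<bar> * \<bar>?D (x - y) - ?D (x + y)\<bar> \<le> B * ?m3 y"
      using B[OF y] B0 by (intro mult_mono) auto
    then show "norm (q y * (?D (x - y) - ?D (x + y))) \<le> B * ?m3 y" by (simp add: abs_mult)
  qed
  also have "\<dots> = B * ?I" using I by (rule integral_unique)
  also have "?I = 2 * ?A (x + 1) + 2 * ?A (2 - x)"
  proof -
    have "?A (x + - 1) = - ?A ((2 - x) + - 1)"
      by (subst arsinh_minus_real[symmetric]) (simp add: algebra_simps)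
    then show ?thesis by simp
  qed
  also have "B * \<dots> \<le> B * (4 * arsinh (2 * real N))"
  proof (intro mult_left_mono B0)
    have "?A (x + 1) \<le> ?A 2" "?A (2 - x) \<le> ?A 2"
      using x by (auto intro!: arsinh_real_mono mult_left_mono)
    then show "2 * ?A (x + 1) + 2 * ?A (2 - x) \<le> 4 * arsinh (2 * real N)" by (simp add: mult.commute)
  qed
  finally show ?thesis using eq by (simp add: mult_ac)
qed

section \<open>The mild periodic solution of the linear problem\<close>

definition eigenval :: "real \<Rightarrow> nat \<Rightarrow> real" where
  "eigenval \<gamma> k = \<gamma> * freq k ^ 4 + freq k ^ 2 - 1"

lemma eigenval_0: "eigenval \<gamma> 0 = \<gamma> * pi ^ 4 + pi ^ 2 - 1"
  by (simp add: eigenval_def freq_def)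

lemma freq_mono: "j \<le> k \<Longrightarrow> freq j \<le> freq k"
  by (simp add: freq_def)

lemma summable_inverse_freq_square: "summable (\<lambda>k. 1 / freq k ^ 2)"
proof -
  have "summable (\<lambda>k. 1 / pi ^ 2 * inverse (real (Suc k) ^ 2))"
    using inverse_power_summable[of 2, where 'a = real] summable_Suc_iff[of "\<lambda>k. inverse (real k ^ 2)"]
    by (intro summable_mult) simp
  also have "(\<lambda>k. 1 / pi ^ 2 * inverse (real (Suc k) ^ 2)) = (\<lambda>k. 1 / freq k ^ 2)"
    unfolding freq_def power_mult_distrib by (simp add: divide_simps mult.commute del: of_nat_Suc)
  finally show ?thesis .
qed

locale efk_operator =
  fixes \<gamma> \<omega> :: real
  assumes \<gamma>_pos: "\<gamma> > 0" and \<omega>_pos: "\<omega> > 0"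
begin

abbreviation ev :: "nat \<Rightarrow> real" where "ev \<equiv> eigenval \<gamma>"

lemma ev_ge: "\<gamma> * freq k ^ 4 \<le> ev k"
  using one_le_power[OF freq_ge_1, of k 2] by (simp add: eigenval_def)

lemma ev_pos: "ev k > 0"
proof -
  have "\<gamma> * freq k ^ 4 > 0" using \<gamma>_pos freq_pos by simp
  then show ?thesis using ev_ge[of k] by linarith
qed

lemma ev_mono: "j \<le> k \<Longrightarrow> ev j \<le> ev k"
  unfolding eigenval_def using \<gamma>_pos freq_pos[of j] freq_mono[of j k]
  by (intro add_mono diff_mono mult_left_mono power_mono) auto

lemma summable_freq_square_over_ev: "summable (\<lambda>k. freq k ^ 2 / ev k)"
proof (rule summable_comparison_test)
  show "\<exists>N. \<forall>k\<ge>N. norm (freq k ^ 2 / ev k) \<le> 1 / \<gamma> * (1 / freq k ^ 2)"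
  proof (intro exI allI impI)
    fix k
    have "freq k ^ 2 / ev k \<le> freq k ^ 2 / (\<gamma> * freq k ^ 4)"
      using ev_ge[of k] \<gamma>_pos freq_pos[of k] ev_pos[of k] by (intro divide_left_mono) auto
    also have "\<dots> = 1 / \<gamma> * (1 / freq k ^ 2)"
      using \<gamma>_pos freq_pos[of k] by (simp add: field_simps power_add[symmetric])
    finally show "norm (freq k ^ 2 / ev k) \<le> 1 / \<gamma> * (1 / freq k ^ 2)" using ev_pos[of k] by simp
  qed
  show "summable (\<lambda>k. 1 / \<gamma> * (1 / freq k ^ 2))" by (intro summable_mult summable_inverse_freq_square)
qed

lemma summable_freq_over_ev: "summable (\<lambda>k. freq k / ev k)"
proof (rule summable_comparison_test[OF _ summable_freq_square_over_ev], intro exI allI impI)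
  fix k
  have "freq k * 1 \<le> freq k * freq k" using freq_ge_1[of k] freq_pos[of k] by (intro mult_left_mono) auto
  then show "norm (freq k / ev k) \<le> freq k ^ 2 / ev k"
    using ev_pos[of k] freq_pos[of k] by (simp add: divide_right_mono power2_eq_square)
qed

lemma summable_inverse_ev: "summable (\<lambda>k. 1 / ev k)"
proof (rule summable_comparison_test[OF _ summable_freq_over_ev], intro exI allI impI)
  fix k
  show "norm (1 / ev k) \<le> freq k / ev k"
    using ev_pos[of k] freq_ge_1[of k] by (simp add: divide_right_mono)
qed

lemma summable_inverse_sqrt_ev: "summable (\<lambda>k. 1 / sqrt (ev k))"
proof (rule summable_comparison_test)
  show "\<exists>N. \<forall>k\<ge>N. norm (1 / sqrt (ev k)) \<le> 1 / sqrt \<gamma> * (1 / freq k ^ 2)"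
  proof (intro exI allI impI)
    fix k
    have "sqrt (freq k ^ 4) = freq k ^ 2" by (rule real_sqrt_unique) auto
    then have "sqrt \<gamma> * freq k ^ 2 = sqrt (\<gamma> * freq k ^ 4)" by (simp add: real_sqrt_mult)
    also have "\<dots> \<le> sqrt (ev k)" using ev_ge by simp
    finally have "1 / sqrt (ev k) \<le> 1 / (sqrt \<gamma> * freq k ^ 2)"
      using \<gamma>_pos freq_pos[of k] by (intro divide_left_mono mult_pos_pos) (auto simp: ev_pos)
    then show "norm (1 / sqrt (ev k)) \<le> 1 / sqrt \<gamma> * (1 / freq k ^ 2)" using ev_pos[of k] by simp
  qed
  show "summable (\<lambda>k. 1 / sqrt \<gamma> * (1 / freq k ^ 2))" by (intro summable_mult summable_inverse_freq_square)
qed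

definition admissible :: "(real \<Rightarrow> real \<Rightarrow> real) \<Rightarrow> bool" where
  "admissible h \<longleftrightarrow> continuous_on (UNIV \<times> {0..1}) (\<lambda>(t, x). h t x) \<and> time_periodic \<omega> h"

lemma admissible_slice: "admissible h \<Longrightarrow> continuous_on {0..1} (h t)"
  by (auto simp: admissible_def intro: continuous_on_slice)

lemma admissible_diff:
  assumes "admissible h" "admissible k"
  shows "admissible (\<lambda>t x. h t x - k t x)"
  using assms continuous_on_diff[of "UNIV \<times> {0..1}" "\<lambda>(t, x). h t x" "\<lambda>(t, x). k t x"]
  by (simp add: admissible_def time_periodic_def case_prod_unfold)

lemma admissible_bounded:
  assumes "admissible h"
  obtains B where "B \<ge> 0" "\<And>t x. x \<in> {0..1} \<Longrightarrow> \<bar>h t x\<bar> \<le> B"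
proof -
  have "continuous_on ({0..\<omega>} \<times> {0..1}) (\<lambda>(t, x). h t x)"
    by (rule continuous_on_subset[of "UNIV \<times> {0..1}"]) (use assms in \<open>auto simp: admissible_def\<close>)
  then have "bounded ((\<lambda>(t, x). h t x) ` ({0..\<omega>} \<times> {0..1}))"
    by (intro compact_imp_bounded compact_continuous_image compact_Times) auto
  then obtain B where "B > 0" and B: "\<And>z. z \<in> (\<lambda>(t, x). h t x) ` ({0..\<omega>} \<times> {0..1}) \<Longrightarrow> norm z \<le> B"
    unfolding bounded_pos by blast
  have "\<bar>h t x\<bar> \<le> B" if x: "x \<in> {0..1}" for t x
  proof -
    have per: "h (t + \<omega>) x = h t x" for t using assms x by (auto simp: admissible_def time_periodic_def)
    obtain s where s: "s \<in> {0..\<omega>}" "h t x = h s x"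
      using periodic_representative[of \<omega> "\<lambda>t. h t x" t, OF \<omega>_pos per] .
    have "h s x \<in> (\<lambda>(t, x). h t x) ` ({0..\<omega>} \<times> {0..1})"
      using s x by (intro image_eqI[of _ _ "(s, x)"]) auto
    then show ?thesis using B[of "h s x"] s by simp
  qed
  then show thesis using that[of B] \<open>B > 0\<close> by simp
qed

lemma admissible_sine_coeff:
  assumes "admissible h"
  shows "continuous_on UNIV (\<lambda>t. sine_coeff (h t) k)" "sine_coeff (h (t + \<omega>)) k = sine_coeff (h t) k"
proof -
  have "continuous_on (UNIV \<times> cbox 0 1) (\<lambda>z. (case z of (t, x) \<Rightarrow> h t x) * sin (freq k * snd z))"
    using assms by (intro continuous_intros) (auto simp: admissible_def)
  then have "continuous_on (UNIV \<times> cbox 0 1) (\<lambda>(t, x). h t x * sin (freq k * x))"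
    by (simp add: case_prod_unfold)
  from integral_continuous_on_param[OF this]
  show "continuous_on UNIV (\<lambda>t. sine_coeff (h t) k)"
    unfolding sine_coeff_def by (intro continuous_intros) simp
  show "sine_coeff (h (t + \<omega>)) k = sine_coeff (h t) k"
    by (rule sine_coeff_cong) (use assms in \<open>auto simp: admissible_def time_periodic_def\<close>)
qed

text \<open>The coefficient of the mild solution at \<open>sin (freq k x)\<close>; \<open>periodic_response_unique\<close> makes the choice
  unambiguous.\<close>

definition mode :: "(real \<Rightarrow> real \<Rightarrow> real) \<Rightarrow> nat \<Rightarrow> real \<Rightarrow> real" where
  "mode h k = (SOME v. periodic_response \<omega> (ev k) (\<lambda>t. sine_coeff (h t) k) v)"

definition mild :: "(real \<Rightarrow> real \<Rightarrow> real) \<Rightarrow> real \<Rightarrow> real \<Rightarrow> real" where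
  "mild h t x = (\<Sum>k. mode h k t * sin (freq k * x))"

lemma mode_response:
  assumes "admissible h"
  shows "periodic_response \<omega> (ev k) (\<lambda>t. sine_coeff (h t) k) (mode h k)"
proof -
  have "\<exists>v. periodic_response \<omega> (ev k) (\<lambda>t. sine_coeff (h t) k) v"
    by (rule periodic_response_exists) (use admissible_sine_coeff[OF assms] \<omega>_pos ev_pos in auto)
  from someI_ex[OF this] show ?thesis by (simp only: mode_def)
qed

lemma mode_eqI:
  assumes "admissible h" "periodic_response \<omega> (ev k) (\<lambda>t. sine_coeff (h t) k) v"
  shows "mode h k = v"
  by (rule periodic_response_unique[OF \<omega>_pos ev_pos mode_response[OF assms(1)] assms(2)])

lemma mode_diff:
  assumes "admissible h" "admissible g"
  shows "mode (\<lambda>t x. h t x - g t x) k t = mode h k t - mode g k t"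
proof -
  have "periodic_response \<omega> (ev k) (\<lambda>t. sine_coeff (\<lambda>x. h t x - g t x) k) (\<lambda>t. mode h k t - mode g k t)"
    using periodic_response_diff[OF mode_response mode_response, OF assms, of k]
      admissible_slice[OF assms(1)] admissible_slice[OF assms(2)]
    by (simp add: sine_coeff_diff)
  from mode_eqI[OF admissible_diff[OF assms] this] show ?thesis by simp
qed

lemma mode_bound:
  assumes "admissible h" "\<And>t. \<bar>sine_coeff (h t) k\<bar> \<le> B"
  shows "\<bar>mode h k t\<bar> \<le> B / ev k"
  by (rule periodic_response_bound[OF \<omega>_pos ev_pos mode_response[OF assms(1)] assms(2)])

text \<open>Bounded data have bounded coefficients, so the coefficients of the mild solution are \<open>O(1 / \<lambda>\<^sub>k)\<close>, that is
  \<open>O(k\<^sup>-\<^sup>4)\<close>: two spatial derivatives leave an absolutely convergent series.\<close>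

lemma mode_summable_majorant:
  assumes "admissible h"
  obtains P where "summable P" "\<And>k t. \<bar>mode h k t * freq k ^ 2\<bar> \<le> P k"
    "\<And>k t. \<bar>mode h k t * freq k\<bar> \<le> P k" "\<And>k t. \<bar>mode h k t\<bar> \<le> P k"
proof -
  obtain B where "B \<ge> 0" and B: "\<And>t x. x \<in> {0..1} \<Longrightarrow> \<bar>h t x\<bar> \<le> B"
    using admissible_bounded[OF assms] by blast
  let ?P = "\<lambda>k. 2 * B * (freq k ^ 2 / ev k)"
  have m: "\<bar>mode h k t\<bar> \<le> 2 * B / ev k" for k t
    by (rule mode_bound[OF assms sine_coeff_bound[OF admissible_slice[OF assms] B]])
  have *: "\<bar>mode h k t * c\<bar> \<le> ?P k" if "0 \<le> c" "c \<le> freq k ^ 2" for k t c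
  proof -
    have "\<bar>mode h k t\<bar> * c \<le> 2 * B / ev k * freq k ^ 2"
      using m that \<open>B \<ge> 0\<close> ev_pos[of k] by (intro mult_mono) auto
    then show ?thesis using that by (simp add: abs_mult)
  qed
  have f: "1 \<le> freq k ^ 2" "freq k \<le> freq k ^ 2" for k
    using freq_ge_1[of k] one_le_power[of "freq k" 2] mult_left_mono[of 1 "freq k" "freq k"]
    by (auto simp: power2_eq_square)
  show thesis
  proof (rule that[of ?P])
    show "summable ?P" by (intro summable_mult summable_freq_square_over_ev)
    show "\<bar>mode h k t * freq k ^ 2\<bar> \<le> ?P k" for k t by (rule *) auto
    show "\<bar>mode h k t * freq k\<bar> \<le> ?P k" for k t using freq_pos[of k] f by (intro *) auto
    show "\<bar>mode h k t\<bar> \<le> ?P k" for k t using *[of 1 k t] f by simp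
  qed
qed

lemma mode_continuous: "admissible h \<Longrightarrow> continuous_on S (mode h k)"
  by (rule periodic_response_continuous[OF mode_response])

lemma admissible_mild:
  assumes "admissible h"
  shows "admissible (mild h)"
proof -
  obtain P where P: "summable P" "\<And>k t. \<bar>mode h k t\<bar> \<le> P k"
    using mode_summable_majorant[OF assms] by metis
  have "continuous_on (UNIV \<times> {0..1}) (\<lambda>(t, x). mild h t x)"
    unfolding mild_def
    by (rule continuous_on_separated_series[OF P mode_continuous[OF assms]]) (auto intro!: continuous_intros)
  moreover have "time_periodic \<omega> (mild h)"
    using periodic_response_periodic[OF mode_response[OF assms]] by (simp add: time_periodic_def mild_def)
  ultimately show ?thesis by (simp add: admissible_def)
qed

lemma sine_coeff_mild:
  assumes "admissible h"
  shows "sine_coeff (mild h t) k = mode h k t"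
proof -
  obtain P where P: "summable P" "\<And>k t. \<bar>mode h k t\<bar> \<le> P k"
    using mode_summable_majorant[OF assms] by metis
  show ?thesis using sine_coeff_sine_series[OF P(1), of "\<lambda>k. mode h k t"] P(2) by (simp add: mild_def[abs_def])
qed

definition mild_x :: "(real \<Rightarrow> real \<Rightarrow> real) \<Rightarrow> real \<Rightarrow> real \<Rightarrow> real" where
  "mild_x h t x = (\<Sum>k. (mode h k t * freq k) * cos (freq k * x))"

definition mild_xx :: "(real \<Rightarrow> real \<Rightarrow> real) \<Rightarrow> real \<Rightarrow> real \<Rightarrow> real" where
  "mild_xx h t x = (\<Sum>k. (- (mode h k t * freq k) * freq k) * sin (freq k * x))"

lemma mild_spatial_derivatives:
  assumes "admissible h"
  shows "(mild h t has_real_derivative mild_x h t x) (at x)"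
    and "(mild_x h t has_real_derivative mild_xx h t x) (at x)"
    and "continuous_on S (\<lambda>(t, x). mild_x h t x)"
    and "continuous_on S (\<lambda>(t, x). mild_xx h t x)"
    and "sine_coeff (mild_xx h t) k = - (mode h k t * freq k) * freq k"
proof -
  obtain P where P: "summable P" "\<And>k t. \<bar>mode h k t * freq k ^ 2\<bar> \<le> P k" "\<And>k t. \<bar>mode h k t * freq k\<bar> \<le> P k"
    using mode_summable_majorant[OF assms] by metis
  have P2: "\<bar>- (mode h k t * freq k) * freq k\<bar> \<le> P k" "\<bar>(mode h k t * freq k) * freq k\<bar> \<le> P k" for k t
    using P(2)[where k=k and t=t] by (simp_all add: power2_eq_square abs_mult mult.assoc)
  show "(mild h t has_real_derivative mild_x h t x) (at x)"
    using sine_series_DERIV[OF P(1) P(3)] by (simp add: mild_def[abs_def] mild_x_def)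
  show "(mild_x h t has_real_derivative mild_xx h t x) (at x)"
    using cosine_series_DERIV[OF P(1) P2(2)] by (simp add: mild_x_def[abs_def] mild_xx_def)
  show "continuous_on S (\<lambda>(t, x). mild_x h t x)"
    unfolding mild_x_def
    by (rule continuous_on_separated_series[OF P(1,3)]) (auto intro!: continuous_intros mode_continuous assms)
  show "continuous_on S (\<lambda>(t, x). mild_xx h t x)"
    unfolding mild_xx_def
    by (rule continuous_on_separated_series[OF P(1) P2(1)]) (auto intro!: continuous_intros mode_continuous assms)
  show "sine_coeff (mild_xx h t) k = - (mode h k t * freq k) * freq k"
    unfolding mild_xx_def[abs_def] by (rule sine_coeff_sine_series[OF P(1) P2(1)])
qed

lemma mild_diff:
  assumes "admissible h" "admissible g"
  shows "mild (\<lambda>t x. h t x - g t x) t x = mild h t x - mild g t x"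
proof -
  have s: "summable (\<lambda>k. mode h k t * sin (freq k * x))" if h: "admissible h" for h
  proof -
    obtain P where P: "summable P" "\<And>k t. \<bar>mode h k t\<bar> \<le> P k"
      using mode_summable_majorant[OF h] by metis
    show ?thesis
    proof (rule summable_comparison_test[OF _ P(1)], intro exI allI impI)
      fix k
      have "\<bar>mode h k t\<bar> * \<bar>sin (freq k * x)\<bar> \<le> \<bar>mode h k t\<bar> * 1" by (intro mult_left_mono) auto
      then show "norm (mode h k t * sin (freq k * x)) \<le> P k" using P(2)[of k t] by (simp add: abs_mult)
    qed
  qed
  show ?thesis
    using suminf_diff[OF s[OF assms(1)] s[OF assms(2)]]
    by (simp add: mild_def mode_diff[OF assms] left_diff_distrib)
qed

text \<open>The bound \<open>sup\<^sub>t \<parallel>h(t)\<parallel> \<le> M\<close> in \<open>L\<^sup>2(0,1)\<close>, stated as a predicate since only bounds are ever compared.\<close>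

definition L2_le :: "(real \<Rightarrow> real \<Rightarrow> real) \<Rightarrow> real \<Rightarrow> bool" where
  "L2_le h M \<longleftrightarrow> (\<forall>t. integral {0..1} (\<lambda>x. (h t x)\<^sup>2) \<le> M\<^sup>2)"

lemma L2_le_sine_coeff:
  assumes "admissible h" "L2_le h M" "finite I"
  shows "(\<Sum>k\<in>I. (sine_coeff (h t) k)\<^sup>2) \<le> (sqrt 2 * M)\<^sup>2"
  using sine_bessel[OF admissible_slice[OF assms(1)] assms(3), of t] assms(2)
  by (auto simp: L2_le_def power_mult_distrib intro: order_trans)

text \<open>This is where the sharp constant \<open>1 / \<lambda>\<^sub>0\<close> enters: the \<open>L\<^sup>2\<close> norm is additive over the modes, and every mode
  decays at least at the rate \<open>\<lambda>\<^sub>0\<close>.\<close>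

lemma mild_L2_le:
  assumes "admissible h" "L2_le h M"
  shows "L2_le (mild h) (M / ev 0)"
  unfolding L2_le_def
proof
  fix t
  obtain P where P: "summable P" "\<And>k t. \<bar>mode h k t\<bar> \<le> P k"
    using mode_summable_majorant[OF assms(1)] by metis
  have "(\<Sum>k<N. (mode h k t)\<^sup>2) \<le> (sqrt 2 * M / ev 0)\<^sup>2" for N
    by (rule sum_squares_periodic_response_le[OF \<omega>_pos _ ev_pos mode_response[OF assms(1)] ev_mono
          L2_le_sine_coeff[OF assms]]) auto
  from integral_sine_series_square_le[OF P(1) P(2) this]
  show "integral {0..1} (\<lambda>x. (mild h t x)\<^sup>2) \<le> (M / ev 0)\<^sup>2"
    by (simp add: mild_def power_mult_distrib power_divide)
qed

definition smoothing_const :: real where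
  "smoothing_const = (\<Sum>k. 2 * (1 / ev k))"

lemma smoothing_const_nonneg: "smoothing_const \<ge> 0"
  unfolding smoothing_const_def using ev_pos
  by (intro suminf_nonneg summable_mult summable_inverse_ev) (simp add: less_imp_le)

text \<open>Bessel's inequality bounds every single coefficient by the \<open>L\<^sup>2\<close> norm, and \<open>\<Sum> 1 / \<lambda>\<^sub>k\<close> converges.\<close>

lemma mild_sup_le:
  assumes "admissible h" "L2_le h M" "M \<ge> 0"
  shows "\<bar>mild h t x\<bar> \<le> smoothing_const * M"
proof -
  have c: "\<bar>sine_coeff (h t) k\<bar> \<le> 2 * M" for t k
  proof (rule power2_le_imp_le)
    have "\<bar>sine_coeff (h t) k\<bar>\<^sup>2 \<le> 2 * M\<^sup>2"
      using L2_le_sine_coeff[OF assms(1,2), of "{k}" t] by (simp add: power_mult_distrib)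
    also have "\<dots> \<le> (2 * M)\<^sup>2" by (simp add: power2_eq_square)
    finally show "\<bar>sine_coeff (h t) k\<bar>\<^sup>2 \<le> (2 * M)\<^sup>2" .
  qed (use assms in auto)
  have le: "norm (mode h k t * sin (freq k * x)) \<le> M * (2 * (1 / ev k))" for k
  proof -
    have "\<bar>mode h k t\<bar> * \<bar>sin (freq k * x)\<bar> \<le> (2 * M / ev k) * 1"
      using assms(3) ev_pos[of k] by (intro mult_mono mode_bound[OF assms(1)] c) auto
    then show ?thesis by (simp add: abs_mult mult_ac)
  qed
  have "norm (mild h t x) \<le> (\<Sum>k. M * (2 * (1 / ev k)))"
    unfolding mild_def by (rule norm_suminf_le[OF le]) (intro summable_mult summable_inverse_ev)
  also have "\<dots> = M * smoothing_const"
    unfolding smoothing_const_def by (intro suminf_mult summable_mult summable_inverse_ev)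
  finally show ?thesis by (simp add: mult.commute)
qed

text \<open>Each mode is Lipschitz in time uniformly in \<open>k\<close> and of size \<open>O(1 / \<lambda>\<^sub>k)\<close>. The geometric mean of the two bounds
  is \<open>O(\<bar>s - t\<bar> powr (1/2) / sqrt \<lambda>\<^sub>k)\<close>, which is summable in \<open>k\<close>.\<close>

lemma mild_time_hoelder:
  assumes "admissible h"
  obtains C where "C \<ge> 0" "\<And>s t x. \<bar>mild h s x - mild h t x\<bar> \<le> C * \<bar>s - t\<bar> powr (1/2)"
proof -
  obtain B where "B \<ge> 0" and B: "\<And>t x. x \<in> {0..1} \<Longrightarrow> \<bar>h t x\<bar> \<le> B"
    using admissible_bounded[OF assms] by blast
  obtain P where P: "summable P" "\<And>k t. \<bar>mode h k t\<bar> \<le> P k"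
    using mode_summable_majorant[OF assms] by metis
  have c: "\<bar>sine_coeff (h t) k\<bar> \<le> 2 * B" for t k
    by (rule sine_coeff_bound[OF admissible_slice[OF assms] B])
  have m: "\<bar>mode h k t\<bar> \<le> 2 * B / ev k" for k t by (rule mode_bound[OF assms c])
  have lip: "\<bar>mode h k s - mode h k t\<bar> \<le> 4 * B * \<bar>s - t\<bar>" for k s t
  proof (rule field_differentiable_bound[where S = UNIV and f' = "\<lambda>t. sine_coeff (h t) k - ev k * mode h k t", simplified real_norm_def])
    show "(mode h k has_field_derivative sine_coeff (h z) k - ev k * mode h k z) (at z within UNIV)" for z
      using periodic_response_DERIV[OF mode_response[OF assms]] by simp
    have "\<bar>ev k * mode h k z\<bar> \<le> 2 * B" for z
      using m[of k z] ev_pos[of k] by (simp add: abs_mult field_simps)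
    then show "\<bar>sine_coeff (h z) k - ev k * mode h k z\<bar> \<le> 4 * B" for z
      using c[of z k] by (smt (verit))
  qed auto
  have hoelder: "\<bar>mode h k s - mode h k t\<bar> \<le> 4 * B * sqrt \<bar>s - t\<bar> * (1 / sqrt (ev k))" for k s t
  proof (rule power2_le_imp_le)
    have "\<bar>mode h k s - mode h k t\<bar> \<le> 4 * B / ev k"
      using m[of k s] m[of k t] by (simp add: abs_if split: if_splits)
    then have "\<bar>mode h k s - mode h k t\<bar> * \<bar>mode h k s - mode h k t\<bar> \<le> (4 * B * \<bar>s - t\<bar>) * (4 * B / ev k)"
      using \<open>B \<ge> 0\<close> lip by (intro mult_mono) auto
    also have "\<dots> = (4 * B * sqrt \<bar>s - t\<bar> * (1 / sqrt (ev k)))\<^sup>2"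
      using ev_pos[of k] by (simp add: power_mult_distrib power_divide) (simp add: power2_eq_square)
    finally show "\<bar>mode h k s - mode h k t\<bar>\<^sup>2 \<le> (4 * B * sqrt \<bar>s - t\<bar> * (1 / sqrt (ev k)))\<^sup>2"
      by (simp only: power2_eq_square)
    show "0 \<le> 4 * B * sqrt \<bar>s - t\<bar> * (1 / sqrt (ev k))" using \<open>B \<ge> 0\<close> ev_pos[of k] by simp
  qed
  let ?C = "4 * B * (\<Sum>k. 1 / sqrt (ev k))"
  show thesis
  proof (rule that[of ?C])
    have "(\<Sum>k. 1 / sqrt (ev k)) \<ge> 0"
      using ev_pos by (intro suminf_nonneg summable_inverse_sqrt_ev) (simp add: less_imp_le)
    then show "?C \<ge> 0" using \<open>B \<ge> 0\<close> by simp
    fix s t x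
    have summ: "summable (\<lambda>k. mode h k r * sin (freq k * x))" for r
    proof (rule summable_comparison_test[OF _ P(1)], intro exI allI impI)
      fix k
      have "\<bar>mode h k r\<bar> * \<bar>sin (freq k * x)\<bar> \<le> \<bar>mode h k r\<bar> * 1" by (intro mult_left_mono) auto
      then show "norm (mode h k r * sin (freq k * x)) \<le> P k" using P(2)[of k r] by (simp add: abs_mult)
    qed
    have eq: "mild h s x - mild h t x = (\<Sum>k. mode h k s * sin (freq k * x) - mode h k t * sin (freq k * x))"
      unfolding mild_def by (rule suminf_diff[OF summ summ])
    have "norm (mild h s x - mild h t x) \<le> (\<Sum>k. 4 * B * sqrt \<bar>s - t\<bar> * (1 / sqrt (ev k)))"
      unfolding eq
    proof (rule norm_suminf_le)
      fix k
      have "\<bar>mode h k s - mode h k t\<bar> * \<bar>sin (freq k * x)\<bar> \<le> \<bar>mode h k s - mode h k t\<bar> * 1"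
        by (intro mult_left_mono) auto
      then show "norm (mode h k s * sin (freq k * x) - mode h k t * sin (freq k * x)) \<le>
          4 * B * sqrt \<bar>s - t\<bar> * (1 / sqrt (ev k))"
        using hoelder[of k s t] unfolding left_diff_distrib[symmetric] by (simp add: abs_mult)
    qed (rule summable_mult[OF summable_inverse_sqrt_ev])
    also have "\<dots> = 4 * B * sqrt \<bar>s - t\<bar> * (\<Sum>k. 1 / sqrt (ev k))"
      by (rule suminf_mult[OF summable_inverse_sqrt_ev, of "4 * B * sqrt \<bar>s - t\<bar>"])
    finally show "\<bar>mild h s x - mild h t x\<bar> \<le> ?C * \<bar>s - t\<bar> powr (1/2)"
      unfolding powr_half_sqrt[OF abs_ge_zero] real_norm_def by (simp only: mult_ac)
  qed
qed

end

section \<open>The time derivative of the mild solution\<close>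

context efk_operator
begin

text \<open>The summand is of order \<open>ln n * n powr (- 1 - 4 \<alpha>)\<close>; part of the exponent is spent on the logarithm.\<close>

lemma abel_majorant_summable:
  assumes "\<alpha> > 0"
  shows "summable (\<lambda>n. arsinh (2 * real (Suc n)) * ((ev (Suc n) - ev n) / ev n * ev (Suc n) powr - \<alpha>))"
proof (rule summable_comparison_test_bigo)
  have "(\<lambda>n. arsinh (2 * real (Suc n))) \<in> O(\<lambda>n. real n powr (2 * \<alpha>))"
    using assms unfolding arsinh_real_def by real_asymp
  moreover have "(\<lambda>n. (ev (Suc n) - ev n) / ev n) \<in> O(\<lambda>n. 1 / real n)"
    using \<gamma>_pos pi_gt_zero unfolding eigenval_def freq_def by real_asymp
  moreover have "(\<lambda>n. ev (Suc n) powr - \<alpha>) \<in> O(\<lambda>n. real n powr (- 4 * \<alpha>))"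
    using \<gamma>_pos pi_gt_zero assms unfolding eigenval_def freq_def by real_asymp
  ultimately have "(\<lambda>n. arsinh (2 * real (Suc n)) * ((ev (Suc n) - ev n) / ev n * ev (Suc n) powr - \<alpha>))
      \<in> O(\<lambda>n. real n powr (2 * \<alpha>) * (1 / real n * real n powr (- 4 * \<alpha>)))"
    by (intro landau_o.big.mult)
  also have "(\<lambda>n. real n powr (2 * \<alpha>) * (1 / real n * real n powr (- 4 * \<alpha>))) \<in> O(\<lambda>n. real n powr (- 1 - 2 * \<alpha>))"
    using assms by real_asymp
  finally show "(\<lambda>n. arsinh (2 * real (Suc n)) * ((ev (Suc n) - ev n) / ev n * ev (Suc n) powr - \<alpha>))
      \<in> O(\<lambda>n. real n powr (- 1 - 2 * \<alpha>))" .
  show "summable (\<lambda>n. norm (real n powr (- 1 - 2 * \<alpha>)))"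
    using assms by (simp add: summable_real_powr_iff)
qed

lemma abel_boundary_tendsto_0:
  assumes "\<alpha> > 0"
  shows "(\<lambda>n. arsinh (2 * real (Suc n)) * ev n powr - \<alpha>) \<longlonglongrightarrow> 0"
  using \<gamma>_pos assms unfolding eigenval_def freq_def arsinh_real_def by real_asymp

lemma arsinh_partial_nonneg: "arsinh (2 * real n) \<ge> 0"
  using arsinh_real_mono[of 0 "2 * real n"] by simp

text \<open>Let \<open>S\<^sub>n\<close> be the \<open>n\<close>-th partial sum of the sine series of \<open>h\<close> at \<open>x\<close>, and \<open>R n j\<close> the derivative of the
  response at rate \<open>\<lambda>\<^sub>j\<close> to \<open>S\<^sub>n\<close>. Since responses are linear in the data, the \<open>k\<close>-th term of the series
  is \<open>R k k - R (k - 1) k\<close>, and summation by parts turns the partial sums into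
  \<open>\<Sum>\<^bsub>n<N\<^esub> (R n n - R n (n + 1)) + R N N\<close>. By the logarithmic bound on partial sums, \<open>S\<^sub>n\<close> inherits the Hoelder
  continuity of \<open>h\<close> with a constant growing logarithmically in \<open>n\<close>, and the estimates on responses then give a
  summable majorant for the sum and a null sequence for the boundary term.\<close>

lemma mode_derivative_series_converges:
  assumes adm: "admissible h" and "\<alpha> > 0" "L \<ge> 0"
    and h: "\<And>s t x. x \<in> {0..1} \<Longrightarrow> \<bar>h s x - h t x\<bar> \<le> L * \<bar>s - t\<bar> powr \<alpha>"
  shows "uniformly_convergent_on (UNIV \<times> {0..1})
    (\<lambda>N z. \<Sum>k<N. (sine_coeff (h (fst z)) k - ev k * mode h k (fst z)) * sin (freq k * snd z))"
proof -
  let ?A = "(UNIV :: real set) \<times> {0..1::real}"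
  let ?f = "\<lambda>N z. \<Sum>k<N. (sine_coeff (h (fst z)) k - ev k * mode h k (fst z)) * sin (freq k * snd z)"
  define S where "S x n t = (\<Sum>k<Suc n. sine_coeff (h t) k * sin (freq k * x))" for x n t
  define V where "V x n j = (SOME v. periodic_response \<omega> (ev j) (S x n) v)" for x n j
  define R where "R x n j t = S x n t - ev j * V x n j t" for x n j t
  define \<Lambda> where "\<Lambda> n = 4 * arsinh (2 * real (Suc n)) * L" for n
  have \<Lambda>: "\<Lambda> n \<ge> 0" for n using \<open>L \<ge> 0\<close> arsinh_partial_nonneg[of "Suc n"] by (simp add: \<Lambda>_def)
  have V: "periodic_response \<omega> (ev j) (S x n) (V x n j)" for x n j
  proof -
    have "continuous_on UNIV (S x n)"
      unfolding S_def by (intro continuous_intros admissible_sine_coeff(1) adm)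
    moreover have "S x n (t + \<omega>) = S x n t" for t
      by (simp add: S_def admissible_sine_coeff(2)[OF adm])
    ultimately have "\<exists>v. periodic_response \<omega> (ev j) (S x n) v"
      by (rule periodic_response_exists[OF \<omega>_pos ev_pos])
    from someI_ex[OF this] show ?thesis by (simp only: V_def)
  qed
  have S_hoelder: "\<bar>S x n s - S x n t\<bar> \<le> \<Lambda> n * \<bar>s - t\<bar> powr \<alpha>" if x: "x \<in> {0..1}" for x n s t
  proof -
    have "S x n s - S x n t = (\<Sum>k<Suc n. sine_coeff (\<lambda>y. h s y - h t y) k * sin (freq k * x))"
      unfolding S_def sum_subtractf[symmetric] left_diff_distrib[symmetric]
      by (simp only: sine_coeff_diff[OF admissible_slice[OF adm] admissible_slice[OF adm]])
    also have "\<bar>\<dots>\<bar> \<le> 4 * arsinh (2 * real (Suc n)) * (L * \<bar>s - t\<bar> powr \<alpha>)"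
      by (rule sine_partial_sum_bound[OF continuous_on_diff h x]) (rule admissible_slice[OF adm])+
    finally show ?thesis by (simp only: \<Lambda>_def mult.assoc)
  qed
  have step: "(sine_coeff (h t) (Suc n) - ev (Suc n) * mode h (Suc n) t) * sin (freq (Suc n) * x) =
      R x (Suc n) (Suc n) t - R x n (Suc n) t" for x n t
  proof -
    have "periodic_response \<omega> (ev (Suc n)) (\<lambda>t. S x (Suc n) t - S x n t)
        (\<lambda>t. V x (Suc n) (Suc n) t - V x n (Suc n) t)"
      by (intro periodic_response_diff V)
    moreover have "periodic_response \<omega> (ev (Suc n)) (\<lambda>t. S x (Suc n) t - S x n t)
        (\<lambda>t. sin (freq (Suc n) * x) * mode h (Suc n) t)"
      using periodic_response_cmult[OF mode_response[OF adm], of "Suc n" "sin (freq (Suc n) * x)"]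
      by (simp add: S_def mult.commute)
    ultimately have "(\<lambda>t. V x (Suc n) (Suc n) t - V x n (Suc n) t) = (\<lambda>t. sin (freq (Suc n) * x) * mode h (Suc n) t)"
      by (rule periodic_response_unique[OF \<omega>_pos ev_pos])
    from fun_cong[OF this, of t] have e: "V x (Suc n) (Suc n) t = V x n (Suc n) t + sin (freq (Suc n) * x) * mode h (Suc n) t"
      by simp
    show ?thesis unfolding R_def e by (simp add: S_def algebra_simps)
  qed
  have start: "(sine_coeff (h t) 0 - ev 0 * mode h 0 t) * sin (freq 0 * x) = R x 0 0 t" for x t
  proof -
    have "periodic_response \<omega> (ev 0) (S x 0) (\<lambda>t. sin (freq 0 * x) * mode h 0 t)"
      using periodic_response_cmult[OF mode_response[OF adm], of 0 "sin (freq 0 * x)"]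
      by (simp add: S_def[abs_def] mult.commute)
    from periodic_response_unique[OF \<omega>_pos ev_pos V this]
    show ?thesis by (simp add: R_def S_def algebra_simps)
  qed
  have abel: "?f (Suc N) (t, x) = (\<Sum>n<N. R x n n t - R x n (Suc n) t) + R x N N t" for N t x
  proof (induction N)
    case 0
    then show ?case by (simp add: start)
  next
    case (Suc N)
    have "?f (Suc (Suc N)) (t, x) = ?f (Suc N) (t, x) + (R x (Suc N) (Suc N) t - R x N (Suc N) t)"
      by (simp add: step)
    then show ?case unfolding Suc.IH by simp
  qed
  have "uniformly_convergent_on ?A (\<lambda>N z. \<Sum>n<N. R (snd z) n n (fst z) - R (snd z) n (Suc n) (fst z))"
  proof (rule Weierstrass_m_test')
    let ?P = "\<lambda>n. 36 * L * (arsinh (2 * real (Suc n)) * ((ev (Suc n) - ev n) / ev n * ev (Suc n) powr - \<alpha>))"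
    show "summable ?P" by (rule summable_mult[OF abel_majorant_summable[OF \<open>\<alpha> > 0\<close>]])
    fix n and z :: "real \<times> real" assume z: "z \<in> ?A"
    have "\<bar>R (snd z) n n (fst z) - R (snd z) n (Suc n) (fst z)\<bar> \<le>
        9 * \<Lambda> n * (ev (Suc n) - ev n) / ev n * ev (Suc n) powr - \<alpha>"
      unfolding R_def using z
      by (intro periodic_response_rate_change[OF \<omega>_pos ev_pos _ \<open>\<alpha> > 0\<close> \<Lambda> V V] S_hoelder ev_mono) auto
    also have "\<dots> = ?P n" by (simp add: \<Lambda>_def)
    finally show "norm (R (snd z) n n (fst z) - R (snd z) n (Suc n) (fst z)) \<le> ?P n" by simp
  qed
  moreover have "uniformly_convergent_on ?A (\<lambda>N z. R (snd z) N N (fst z))"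
  proof -
    have "(\<lambda>n. 12 * L * (arsinh (2 * real (Suc n)) * ev n powr - \<alpha>)) \<longlonglongrightarrow> 12 * L * 0"
      by (intro tendsto_mult tendsto_const abel_boundary_tendsto_0 \<open>\<alpha> > 0\<close>)
    then have lim: "(\<lambda>n. 12 * L * (arsinh (2 * real (Suc n)) * ev n powr - \<alpha>)) \<longlonglongrightarrow> 0" by simp
    have bd: "\<bar>R (snd z) n n (fst z)\<bar> \<le> 12 * L * (arsinh (2 * real (Suc n)) * ev n powr - \<alpha>)" if z: "z \<in> ?A" for n z
    proof -
      have "\<bar>R (snd z) n n (fst z)\<bar> \<le> 3 * \<Lambda> n * ev n powr - \<alpha>"
        unfolding R_def using z
        by (intro periodic_response_DERIV_bound[OF \<omega>_pos ev_pos \<open>\<alpha> > 0\<close> \<Lambda> V] S_hoelder) auto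
      then show ?thesis by (simp add: \<Lambda>_def mult_ac)
    qed
    have "uniform_limit ?A (\<lambda>N z. R (snd z) N N (fst z)) (\<lambda>_. 0) sequentially"
    proof (rule uniform_limitI)
      fix e :: real assume "e > 0"
      have "eventually (\<lambda>n. 12 * L * (arsinh (2 * real (Suc n)) * ev n powr - \<alpha>) < e) sequentially"
        by (rule order_tendstoD(2)[OF lim \<open>e > 0\<close>])
      then show "\<forall>\<^sub>F n in sequentially. \<forall>z\<in>?A. dist (R (snd z) n n (fst z)) 0 < e"
      proof eventually_elim
        case (elim n)
        show ?case
        proof
          fix z assume "z \<in> ?A"
          from bd[OF this, of n] elim show "dist (R (snd z) n n (fst z)) 0 < e" by (simp add: dist_real_def)
        qed
      qed
    qed
    then show ?thesis by (auto simp: uniformly_convergent_on_def)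
  qed
  ultimately have "uniformly_convergent_on ?A
      (\<lambda>N z. (\<Sum>n<N. R (snd z) n n (fst z) - R (snd z) n (Suc n) (fst z)) + R (snd z) N N (fst z))"
    by (rule uniformly_convergent_add)
  moreover have "(\<lambda>N z. (\<Sum>n<N. R (snd z) n n (fst z) - R (snd z) n (Suc n) (fst z)) + R (snd z) N N (fst z)) =
      (\<lambda>N. ?f (Suc N))"
  proof (intro ext)
    fix N and z :: "real \<times> real"
    show "(\<Sum>n<N. R (snd z) n n (fst z) - R (snd z) n (Suc n) (fst z)) + R (snd z) N N (fst z) = ?f (Suc N) z"
      using abel[where N = N and t = "fst z" and x = "snd z"] by (simp only: prod.collapse)
  qed
  ultimately have "uniformly_convergent_on ?A (\<lambda>N. ?f (Suc N))" by (simp only:)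
  then obtain l where l: "uniform_limit ?A (\<lambda>N. ?f (Suc N)) l sequentially"
    unfolding uniformly_convergent_on_def by (elim exE)
  have "uniform_limit ?A ?f l sequentially"
  proof (rule uniform_limitI)
    fix e :: real assume "e > 0"
    show "\<forall>\<^sub>F n in sequentially. \<forall>z\<in>?A. dist (?f n z) (l z) < e"
      by (rule eventually_sequentially_Suc[THEN iffD1], rule uniform_limitD[OF l \<open>e > 0\<close>])
  qed
  then show ?thesis unfolding uniformly_convergent_on_def by blast
qed

text \<open>The series is differentiated term by term; its coefficients are read off by differentiating the
  coefficients of \<open>mild h\<close> in time.\<close>

lemma mild_time_derivative:
  assumes adm: "admissible h" and "\<alpha> > 0" "L \<ge> 0"
    and h: "\<And>s t x. x \<in> {0..1} \<Longrightarrow> \<bar>h s x - h t x\<bar> \<le> L * \<bar>s - t\<bar> powr \<alpha>"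
  obtains ut where "\<And>t x. x \<in> {0..1} \<Longrightarrow> ((\<lambda>s. mild h s x) has_real_derivative ut t x) (at t)"
    "continuous_on (UNIV \<times> {0..1}) (\<lambda>(t, x). ut t x)"
    "\<And>t k. sine_coeff (ut t) k = sine_coeff (h t) k - ev k * mode h k t"
proof -
  let ?d = "\<lambda>k t. sine_coeff (h t) k - ev k * mode h k t"
  let ?A = "(UNIV :: real set) \<times> {0..1::real}"
  obtain l where l: "uniform_limit ?A (\<lambda>N z. \<Sum>k<N. ?d k (fst z) * sin (freq k * snd z)) l sequentially"
    using mode_derivative_series_converges[OF assms] unfolding uniformly_convergent_on_def by auto
  define ut where "ut t x = l (t, x)" for t x
  have cont: "continuous_on ?A l"
    by (rule uniform_limit_theorem[OF _ l])
      (auto intro!: always_eventually continuous_intros mode_continuous adm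
        continuous_on_compose2[OF admissible_sine_coeff(1)[OF adm]]
        continuous_on_compose2[OF mode_continuous[OF adm, of UNIV]])
  obtain P where P: "summable P" "\<And>k t. \<bar>mode h k t\<bar> \<le> P k"
    using mode_summable_majorant[OF adm] by metis
  have der: "((\<lambda>s. mild h s x) has_real_derivative ut t x) (at t)" if x: "x \<in> {0..1}" for t x
  proof -
    have ul: "uniform_limit UNIV (\<lambda>N s. \<Sum>k<N. ?d k s * sin (freq k * x)) (\<lambda>s. ut s x) sequentially"
      using uniform_limit_compose'[OF l, of "\<lambda>s. (s, x)" UNIV] x by (simp add: ut_def)
    have summ: "summable (\<lambda>k. mode h k r * sin (freq k * x))" for r
    proof (rule summable_comparison_test[OF _ P(1)], intro exI allI impI)
      fix k
      have "\<bar>mode h k r\<bar> * \<bar>sin (freq k * x)\<bar> \<le> \<bar>mode h k r\<bar> * 1" by (intro mult_left_mono) auto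
      then show "norm (mode h k r * sin (freq k * x)) \<le> P k" using P(2)[of k r] by (simp add: abs_mult)
    qed
    have d: "((\<lambda>s. mode h k s * sin (freq k * x)) has_real_derivative ?d k s * sin (freq k * x)) (at s within UNIV)" for k s
      by (rule DERIV_cmult_right) (rule periodic_response_DERIV[OF mode_response[OF adm]])
    obtain m where m: "\<And>s. (\<lambda>k. mode h k s * sin (freq k * x)) sums m s"
        "\<And>s. (m has_real_derivative ut s x) (at s)"
      using has_field_derivative_series[OF convex_UNIV d ul UNIV_I summ] by auto
    have "m = (\<lambda>s. mild h s x)" using m(1) by (auto simp: mild_def sums_iff)
    then show ?thesis using m(2) by simp
  qed
  have cont': "continuous_on ?A (\<lambda>(t, x). ut t x)" using cont by (simp add: ut_def)
  have coeff: "sine_coeff (ut t) k = ?d k t" for t k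
  proof (rule DERIV_unique)
    show "((\<lambda>t. sine_coeff (mild h t) k) has_real_derivative sine_coeff (ut t) k) (at t)"
      by (rule sine_coeff_time_DERIV[OF der cont' admissible_slice[OF admissible_mild[OF adm]]])
    show "((\<lambda>t. sine_coeff (mild h t) k) has_real_derivative ?d k t) (at t)"
      unfolding sine_coeff_mild[OF adm] by (rule periodic_response_DERIV[OF mode_response[OF adm]])
  qed
  show thesis by (rule that[OF der cont' coeff])
qed

end

section \<open>Mild solutions and classical solutions\<close>

lemma has_real_derivative_within_unit_unique:
  assumes "(f has_real_derivative a) (at x within {0..1})" "(f has_real_derivative b) (at x within {0..1})"
    and "x \<in> {0..1}"
  shows "a = b"
  using vector_derivative_unique_within_closed_interval[of 0 1 x f a b] assms
  by (simp add: has_real_derivative_iff_has_vector_derivative)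

context efk_operator
begin

lemma sine_coeff_equation:
  assumes "continuous_on {0..1} a" "continuous_on {0..1} b" "continuous_on {0..1} c" "continuous_on {0..1} d"
  shows "sine_coeff (\<lambda>x. (a x - b x + c x + d x) / \<gamma>) k =
    (sine_coeff a k - sine_coeff b k + sine_coeff c k + sine_coeff d k) / \<gamma>"
proof -
  have "sine_coeff (\<lambda>x. (a x - b x + c x + d x) / \<gamma>) k = 1 / \<gamma> * sine_coeff (\<lambda>x. a x - b x + c x + d x) k"
    using sine_coeff_cmult[of "1 / \<gamma>"] by simp
  also have "sine_coeff (\<lambda>x. a x - b x + c x + d x) k =
      sine_coeff a k - sine_coeff b k + sine_coeff c k + sine_coeff d k"
    using assms by (simp add: sine_coeff_add sine_coeff_diff continuous_on_add continuous_on_diff)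
  finally show ?thesis by simp
qed

text \<open>The fourth derivative cannot be reached by summing its series. Instead it is defined by the equation
  as \<open>q = (h - u\<^sub>t + u\<^sub>x\<^sub>x + u) / \<gamma>\<close>, whose coefficients are \<open>freq k ^ 4\<close> times those of \<open>u\<close>.\<close>

lemma mild_regular:
  assumes adm: "admissible h" and "\<alpha> > 0" "L \<ge> 0"
    and h: "\<And>s t x. x \<in> {0..1} \<Longrightarrow> \<bar>h s x - h t x\<bar> \<le> L * \<bar>s - t\<bar> powr \<alpha>"
  obtains ut uxxx uxxxx where "C12 (mild h)"
    "\<And>t x. x \<in> {0<..<1} \<Longrightarrow> ((\<lambda>s. mild h s x) has_real_derivative ut t x) (at t)"
    "\<And>t x. x \<in> {0<..<1} \<Longrightarrow> (mild_xx h t has_real_derivative uxxx t x) (at x)"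
    "\<And>t x. x \<in> {0<..<1} \<Longrightarrow> (uxxx t has_real_derivative uxxxx t x) (at x)"
    "\<And>t x. ut t x + \<gamma> * uxxxx t x - mild_xx h t x - mild h t x = h t x"
    "\<And>t. mild h t 0 = 0" "\<And>t. mild h t 1 = 0" "\<And>t. mild_xx h t 0 = 0" "\<And>t. mild_xx h t 1 = 0"
proof -
  obtain ut where ut: "\<And>t x. x \<in> {0..1} \<Longrightarrow> ((\<lambda>s. mild h s x) has_real_derivative ut t x) (at t)"
    "continuous_on (UNIV \<times> {0..1}) (\<lambda>(t, x). ut t x)"
    "\<And>t k. sine_coeff (ut t) k = sine_coeff (h t) k - ev k * mode h k t"
    using mild_time_derivative[OF assms] by blast
  note d = mild_spatial_derivatives[OF adm]
  define q where "q t x = (h t x - ut t x + mild_xx h t x + mild h t x) / \<gamma>" for t x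
  have slices: "continuous_on {0..1} (h t)" "continuous_on {0..1} (ut t)"
    "continuous_on {0..1} (mild_xx h t)" "continuous_on {0..1} (mild h t)" for t
    using admissible_slice[OF adm] admissible_slice[OF admissible_mild[OF adm]]
      continuous_on_slice[OF ut(2)] continuous_on_slice[OF d(4)] by auto
  have "\<exists>p'. (\<forall>x\<in>{0<..<1}. (mild_xx h t has_real_derivative p' x) (at x)) \<and>
      (\<forall>x\<in>{0<..<1}. (p' has_real_derivative q t x) (at x)) \<and> mild_xx h t 0 = 0 \<and> mild_xx h t 1 = 0" for t
  proof -
    have qc: "continuous_on {0..1} (q t)"
      unfolding q_def using \<gamma>_pos by (intro continuous_intros slices) auto
    have "sine_coeff (q t) k = - (freq k ^ 2) * sine_coeff (mild_xx h t) k" for k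
    proof -
      have "sine_coeff (q t) k = (ev k - freq k ^ 2 + 1) * mode h k t / \<gamma>"
        unfolding q_def[abs_def] sine_coeff_equation[OF slices] ut(3) d(5) sine_coeff_mild[OF adm]
        by (simp add: algebra_simps power2_eq_square)
      also have "\<dots> = freq k ^ 4 * mode h k t" using \<gamma>_pos by (simp add: eigenval_def)
      also have "\<dots> = - (freq k ^ 2) * sine_coeff (mild_xx h t) k"
        unfolding d(5) by (simp add: power2_eq_square power4_eq_xxxx mult_ac)
      finally show ?thesis .
    qed
    from weak_second_derivative_imp_strong[OF slices(3) qc this] show ?thesis by metis
  qed
  then obtain uxxx where uxxx: "\<And>t x. x \<in> {0<..<1} \<Longrightarrow> (mild_xx h t has_real_derivative uxxx t x) (at x)"
    "\<And>t x. x \<in> {0<..<1} \<Longrightarrow> (uxxx t has_real_derivative q t x) (at x)"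
    "\<And>t. mild_xx h t 0 = 0" "\<And>t. mild_xx h t 1 = 0"
    by metis
  have "C12 (mild h)"
    unfolding C12_def
    by (rule exI[of _ ut], rule exI[of _ "mild_x h"], rule exI[of _ "mild_xx h"])
      (use ut(1,2) d(1-4) admissible_mild[OF adm] in
        \<open>auto simp: admissible_def intro: has_field_derivative_at_within\<close>)
  moreover have "ut t x + \<gamma> * q t x - mild_xx h t x - mild h t x = h t x" for t x
    using \<gamma>_pos by (simp add: q_def)
  moreover have "mild h t 0 = 0" "mild h t 1 = 0" for t by (simp_all add: mild_def)
  ultimately show thesis using that[of ut uxxx q] ut(1) uxxx by auto
qed

text \<open>The equation expresses the fourth derivative through functions that are continuous on the closed
  strip, so Green's identity applies twice, to \<open>v\<close> and to \<open>v\<^sub>x\<^sub>x\<close>, and every sine coefficient of \<open>v\<close> solves the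
  scalar equation of its mode. The derivatives \<open>wt\<close>, \<open>wx\<close>, \<open>wxx\<close> supplied by \<open>C12\<close> are identified with those
  of the classical solution by uniqueness of derivatives.\<close>

lemma classical_imp_mild:
  assumes adm: "admissible h" and v: "C12 v" "time_periodic \<omega> v"
    and sol: "\<And>t x. x \<in> {0..1} \<Longrightarrow> (v t has_real_derivative vx t x) (at x within {0..1})"
    "\<And>t x. x \<in> {0..1} \<Longrightarrow> (vx t has_real_derivative vxx t x) (at x within {0..1})"
    "\<And>t x. x \<in> {0<..<1} \<Longrightarrow> ((\<lambda>s. v s x) has_real_derivative vt t x) (at t)"
    "\<And>t x. x \<in> {0<..<1} \<Longrightarrow> (vxx t has_real_derivative vxxx t x) (at x)"
    "\<And>t x. x \<in> {0<..<1} \<Longrightarrow> (vxxx t has_real_derivative vxxxx t x) (at x)"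
    "\<And>t x. x \<in> {0<..<1} \<Longrightarrow> vt t x + \<gamma> * vxxxx t x - vxx t x - v t x = h t x"
    "\<And>t. v t 0 = 0" "\<And>t. v t 1 = 0" "\<And>t. vxx t 0 = 0" "\<And>t. vxx t 1 = 0"
    and x: "x \<in> {0..1}"
  shows "v t x = mild h t x"
proof -
  obtain wt wx wxx where w:
    "\<And>t x. x \<in> {0..1} \<Longrightarrow> ((\<lambda>s. v s x) has_real_derivative wt t x) (at t)"
    "\<And>t x. x \<in> {0..1} \<Longrightarrow> (v t has_real_derivative wx t x) (at x within {0..1})"
    "\<And>t x. x \<in> {0..1} \<Longrightarrow> (wx t has_real_derivative wxx t x) (at x within {0..1})"
    "continuous_on (UNIV \<times> {0..1}) (\<lambda>(t, x). v t x)"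
    "continuous_on (UNIV \<times> {0..1}) (\<lambda>(t, x). wt t x)"
    "continuous_on (UNIV \<times> {0..1}) (\<lambda>(t, x). wxx t x)"
    using v(1) unfolding C12_def by blast
  have wx: "wx t x = vx t x" if "x \<in> {0..1}" for t x
    using has_real_derivative_within_unit_unique[OF w(2) sol(1)] that by blast
  have wxx: "wxx t x = vxx t x" if x: "x \<in> {0..1}" for t x
  proof -
    have "(vx t has_real_derivative wxx t x) (at x within {0..1})"
      by (rule has_field_derivative_transform_within[OF w(3)[OF x] zero_less_one x]) (simp add: wx)
    then show ?thesis using has_real_derivative_within_unit_unique[OF _ sol(2)] x by blast
  qed
  have wt: "wt t x = vt t x" if "x \<in> {0<..<1}" for t x
    using DERIV_unique[OF w(1) sol(3)] that by auto
  have at: "(F has_real_derivative D) (at x)"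
    if "(F has_real_derivative D) (at x within {0..1})" "x \<in> {0<..<1}" for F D and x :: real
    using that at_within_Icc_at[of 0 x 1] by simp
  have slices: "continuous_on {0..1} (h t)" "continuous_on {0..1} (wt t)"
    "continuous_on {0..1} (wxx t)" "continuous_on {0..1} (v t)" for t
    using admissible_slice[OF adm] continuous_on_slice[OF w(4)]
      continuous_on_slice[OF w(5)] continuous_on_slice[OF w(6)] by auto
  define q where "q t x = (h t x - wt t x + wxx t x + v t x) / \<gamma>" for t x
  have qc: "continuous_on {0..1} (q t)" for t
    unfolding q_def using \<gamma>_pos by (intro continuous_intros slices) auto
  have q: "vxxxx t x = q t x" if x: "x \<in> {0<..<1}" for t x
    using sol(6)[OF x, of t] wt[OF x] wxx[of x t] x \<gamma>_pos by (simp add: q_def field_simps)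
  have xx: "sine_coeff (wxx t) k = - (freq k ^ 2) * sine_coeff (v t) k" for t k
  proof (rule sine_coeff_second_derivative[OF slices(4) slices(3)])
    show "(v t has_real_derivative wx t x) (at x)" if "x \<in> {0<..<1}" for x
      using that by (intro at w) auto
    show "(wx t has_real_derivative wxx t x) (at x)" if "x \<in> {0<..<1}" for x
      using that by (intro at w) auto
  qed (use sol in auto)
  have xxxx: "sine_coeff (q t) k = - (freq k ^ 2) * sine_coeff (wxx t) k" for t k
  proof (rule sine_coeff_second_derivative[OF slices(3) qc])
    show "(wxx t has_real_derivative vxxx t x) (at x)" if x: "x \<in> {0<..<1}" for x
      by (rule has_field_derivative_transform_within_open[OF sol(4)[OF x], of "{0<..<1}"])
        (use x wxx in auto)
    show "(vxxx t has_real_derivative q t x) (at x)" if x: "x \<in> {0<..<1}" for x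
      using sol(5)[OF x, of t] q[OF x] by simp
  qed (use sol wxx in auto)
  have time: "sine_coeff (wt t) k = sine_coeff (h t) k - ev k * sine_coeff (v t) k" for t k
  proof -
    have "sine_coeff (q t) k =
        (sine_coeff (h t) k - sine_coeff (wt t) k + sine_coeff (wxx t) k + sine_coeff (v t) k) / \<gamma>"
      unfolding q_def[abs_def] by (rule sine_coeff_equation[OF slices])
    then have "\<gamma> * sine_coeff (q t) k =
        sine_coeff (h t) k - sine_coeff (wt t) k + sine_coeff (wxx t) k + sine_coeff (v t) k"
      using \<gamma>_pos by (simp add: field_simps)
    then show ?thesis unfolding xxxx xx
      by (simp add: eigenval_def algebra_simps power2_eq_square power4_eq_xxxx)
  qed
  have "periodic_response \<omega> (ev k) (\<lambda>t. sine_coeff (h t) k) (\<lambda>t. sine_coeff (v t) k)" for k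
    unfolding periodic_response_def
  proof (intro conjI allI)
    show "sine_coeff (v (t + \<omega>)) k = sine_coeff (v t) k" for t
      by (rule sine_coeff_cong) (use v(2) in \<open>auto simp: time_periodic_def\<close>)
    show "((\<lambda>t. sine_coeff (v t) k) has_real_derivative sine_coeff (h t) k - ev k * sine_coeff (v t) k) (at t)" for t
      using sine_coeff_time_DERIV[OF w(1) w(5) slices(4), of k t] by (simp add: time)
  qed
  from mode_eqI[OF adm this] have "sine_coeff (v t) k = sine_coeff (mild h t) k" for k
    by (simp add: sine_coeff_mild[OF adm])
  then show ?thesis
    by (rule sine_coeff_eq_imp_eq[OF slices(4) admissible_slice[OF admissible_mild[OF adm]] _ x])
qed

lemma L2_le_cong:
  assumes "L2_le h M" "\<And>t x. x \<in> {0..1} \<Longrightarrow> h t x = k t x"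
  shows "L2_le k M"
proof -
  have "integral {0..1} (\<lambda>x. (k t x)\<^sup>2) = integral {0..1} (\<lambda>x. (h t x)\<^sup>2)" for t
    by (rule integral_cong) (simp add: assms(2))
  with assms(1) show ?thesis by (simp add: L2_le_def)
qed

lemma L2_le_sup:
  assumes "admissible h" "\<And>t x. x \<in> {0..1} \<Longrightarrow> \<bar>h t x\<bar> \<le> B"
  shows "L2_le h B"
  unfolding L2_le_def
proof
  fix t
  have "integral {0..1} (\<lambda>x. (h t x)\<^sup>2) \<le> integral {0..1} (\<lambda>x::real. B\<^sup>2)"
  proof (intro integral_le integrable_on_unit_interval continuous_intros admissible_slice assms(1))
    fix x :: real assume "x \<in> {0..1}"
    from power_mono[OF assms(2)[OF this, of t], of 2] show "(h t x)\<^sup>2 \<le> B\<^sup>2" by simp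
  qed
  then show "integral {0..1} (\<lambda>x. (h t x)\<^sup>2) \<le> B\<^sup>2" by simp
qed

lemma mild_diff_sup_le:
  assumes "admissible h" "admissible k" "L2_le (\<lambda>t x. h t x - k t x) M" "M \<ge> 0"
  shows "\<bar>mild h t x - mild k t x\<bar> \<le> smoothing_const * M"
  using mild_sup_le[OF admissible_diff[OF assms(1,2)] assms(3,4)] by (simp add: mild_diff[OF assms(1,2)])

lemma mild_diff_L2_le:
  assumes "admissible h" "admissible k" "L2_le (\<lambda>t x. h t x - k t x) M"
  shows "L2_le (\<lambda>t x. mild h t x - mild k t x) (M / ev 0)"
  using mild_L2_le[OF admissible_diff[OF assms(1,2)] assms(3)]
  by (rule L2_le_cong) (simp add: mild_diff[OF assms(1,2)])

end

section \<open>The delayed problem as a fixed point problem\<close>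

lemma hoelder_imp_continuous_on:
  assumes "hoelder_continuous_on S h"
  shows "continuous_on S h"
proof -
  obtain \<alpha> C where "0 < \<alpha>" and h: "\<And>p q. p \<in> S \<Longrightarrow> q \<in> S \<Longrightarrow> dist (h p) (h q) \<le> C * dist p q powr \<alpha>"
    using assms unfolding hoelder_continuous_on_def by blast
  show ?thesis
    unfolding continuous_on_def
  proof
    fix p assume p: "p \<in> S"
    have "((\<lambda>q. C * dist q p powr \<alpha>) \<longlongrightarrow> C * 0 powr \<alpha>) (at p within S)"
    proof (intro tendsto_intros tendsto_powr')
      show "((\<lambda>q. dist q p) \<longlongrightarrow> 0) (at p within S)"
        using tendsto_dist[OF tendsto_ident_at[of p S] tendsto_const[of p]] by simp
    qed (use \<open>0 < \<alpha>\<close> in auto)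
    then have lim: "((\<lambda>q. C * dist q p powr \<alpha>) \<longlongrightarrow> 0) (at p within S)" using \<open>0 < \<alpha>\<close> by simp
    have "((\<lambda>q. dist (h q) (h p)) \<longlongrightarrow> 0) (at p within S)"
    proof (rule tendsto_sandwich[OF _ _ tendsto_const lim])
      show "\<forall>\<^sub>F q in at p within S. dist (h q) (h p) \<le> C * dist q p powr \<alpha>"
        using h p by (auto simp: eventually_at_filter)
    qed auto
    then show "(h \<longlongrightarrow> h p) (at p within S)" by (rule tendsto_dist_iff[THEN iffD2])
  qed
qed

lemma powr_le_powr_min_exponent:
  assumes "0 \<le> d" "d \<le> (1::real)" "0 < a" "a \<le> b"
  shows "d powr b \<le> d powr a"
  using assms powr_mono'[of a b d] by (cases "d = 0") auto

locale delayed_efk = efk_operator +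
  fixes \<tau> \<beta> :: "'n::finite \<Rightarrow> real" and f :: "real^'n \<Rightarrow> real" and g :: "real \<Rightarrow> real \<Rightarrow> real"
  assumes g_hoelder: "hoelder_continuous_on (UNIV \<times> {0..1}) (\<lambda>(t, x). g t x)"
    and g_periodic: "time_periodic \<omega> g"
    and \<beta>_pos: "\<And>k. \<beta> k > 0"
    and f_lipschitz: "\<And>\<xi> \<eta>. \<bar>f \<xi> - f \<eta>\<bar> \<le> (\<Sum>k\<in>UNIV. \<beta> k * \<bar>\<xi> $ k - \<eta> $ k\<bar>)"
    and \<beta>_small: "(\<Sum>k\<in>UNIV. \<beta> k) < eigenval \<gamma> 0"
begin

definition source :: "(real \<Rightarrow> real \<Rightarrow> real) \<Rightarrow> real \<Rightarrow> real \<Rightarrow> real" where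
  "source u t x = g t x + f (\<chi> k. u (t - \<tau> k) x)"

definition lip :: real where
  "lip = (\<Sum>k\<in>UNIV. \<beta> k)"

lemma lip_nonneg: "lip \<ge> 0"
  unfolding lip_def using \<beta>_pos by (intro sum_nonneg) (simp add: less_imp_le)

definition contraction :: real where
  "contraction = lip / ev 0"

lemma contraction_nonneg: "0 \<le> contraction" and contraction_less_1: "contraction < 1"
  using lip_nonneg ev_pos[of 0] \<beta>_small by (simp_all add: contraction_def lip_def)

lemma f_continuous: "continuous_on UNIV f"
  unfolding continuous_on_def
proof
  fix \<eta> :: "real^'n"
  have "((\<lambda>\<xi>. \<Sum>k\<in>UNIV. \<beta> k * \<bar>\<xi> $ k - \<eta> $ k\<bar>) \<longlongrightarrow> (\<Sum>k\<in>UNIV. \<beta> k * \<bar>\<eta> $ k - \<eta> $ k\<bar>)) (at \<eta>)"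
    by (intro tendsto_intros)
  then have lim: "((\<lambda>\<xi>. \<Sum>k\<in>UNIV. \<beta> k * \<bar>\<xi> $ k - \<eta> $ k\<bar>) \<longlongrightarrow> 0) (at \<eta>)" by simp
  have "((\<lambda>\<xi>. dist (f \<xi>) (f \<eta>)) \<longlongrightarrow> 0) (at \<eta>)"
    by (rule tendsto_sandwich[OF _ _ tendsto_const lim])
      (use f_lipschitz in \<open>auto simp: dist_real_def\<close>)
  then show "(f \<longlongrightarrow> f \<eta>) (at \<eta>)" by (rule tendsto_dist_iff[THEN iffD2])
qed

lemma source_diff_pointwise:
  "\<bar>source u s x - source v t x\<bar> \<le> \<bar>g s x - g t x\<bar> + (\<Sum>k\<in>UNIV. \<beta> k * \<bar>u (s - \<tau> k) x - v (t - \<tau> k) x\<bar>)"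
  using f_lipschitz[of "\<chi> k. u (s - \<tau> k) x" "\<chi> k. v (t - \<tau> k) x"] by (simp add: source_def)

lemma admissible_source:
  assumes "admissible u"
  shows "admissible (source u)"
proof -
  have u: "continuous_on (UNIV \<times> {0..1}) (\<lambda>(t, x). u t x)" using assms by (simp add: admissible_def)
  have shift: "continuous_on (UNIV \<times> {0..1}) (\<lambda>z. u (fst z - \<tau> k) (snd z))" for k
  proof -
    have "continuous_on (UNIV \<times> {0..1}) (\<lambda>z::real\<times>real. (fst z - \<tau> k, snd z))" by (intro continuous_intros)
    from continuous_on_compose2[OF u this] show ?thesis by (simp add: image_subset_iff mem_Times_iff)
  qed
  have g: "continuous_on (UNIV \<times> {0..1}) (\<lambda>z. g (fst z) (snd z))"
    using hoelder_imp_continuous_on[OF g_hoelder] by (simp add: case_prod_unfold)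
  have "continuous_on (UNIV \<times> {0..1}) (\<lambda>z. g (fst z) (snd z) + f (\<chi> k. u (fst z - \<tau> k) (snd z)))"
    by (intro continuous_on_add g continuous_on_compose2[OF f_continuous] continuous_on_vec_lambda shift) auto
  then have "continuous_on (UNIV \<times> {0..1}) (\<lambda>(t, x). source u t x)"
    by (simp add: source_def case_prod_unfold)
  moreover have "time_periodic \<omega> (source u)"
    unfolding time_periodic_def
  proof (intro allI ballI)
    fix t x :: real assume x: "x \<in> {0..1}"
    have "u (t + \<omega> - \<tau> k) x = u (t - \<tau> k) x" for k
      using assms x unfolding admissible_def time_periodic_def by (metis add.commute add_diff_eq)
    then show "source u (t + \<omega>) x = source u t x"
      using g_periodic x by (simp add: source_def time_periodic_def)
  qed
  ultimately show ?thesis by (simp add: admissible_def)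
qed

text \<open>Cauchy-Schwarz with the weights \<open>\<beta>\<^sub>k\<close> gives \<open>(\<Sum> \<beta>\<^sub>k \<bar>d\<^sub>k\<bar>)\<^sup>2 \<le> (\<Sum> \<beta>\<^sub>k) (\<Sum> \<beta>\<^sub>k d\<^sub>k\<^sup>2)\<close> pointwise in \<open>x\<close>; each delayed difference
  \<open>d\<^sub>k\<close> has the same \<open>L\<^sup>2\<close> bound \<open>M\<close>, uniformly in time.\<close>

lemma source_L2_lipschitz:
  assumes "admissible u" "admissible v" "L2_le (\<lambda>t x. u t x - v t x) M"
  shows "L2_le (\<lambda>t x. source u t x - source v t x) (lip * M)"
  unfolding L2_le_def
proof
  fix t
  let ?d = "\<lambda>k x. u (t - \<tau> k) x - v (t - \<tau> k) x"
  have d: "continuous_on {0..1} (?d k)" for k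
    using assms by (intro continuous_intros admissible_slice)
  have "integral {0..1} (\<lambda>x. (source u t x - source v t x)\<^sup>2) \<le>
      integral {0..1} (\<lambda>x. lip * (\<Sum>k\<in>UNIV. \<beta> k * (?d k x)\<^sup>2))"
  proof (intro integral_le integrable_on_unit_interval continuous_intros d admissible_slice admissible_source assms)
    fix x :: real
    have "\<bar>source u t x - source v t x\<bar> \<le> (\<Sum>k\<in>UNIV. \<beta> k * \<bar>?d k x\<bar>)"
      using source_diff_pointwise[of u t x v t] by simp
    also have "\<dots> = (\<Sum>k\<in>UNIV. sqrt (\<beta> k) * (sqrt (\<beta> k) * \<bar>?d k x\<bar>))"
      using \<beta>_pos by (simp add: mult.assoc[symmetric] less_imp_le)
    finally have "\<bar>source u t x - source v t x\<bar>\<^sup>2 \<le> (\<Sum>k\<in>UNIV. sqrt (\<beta> k) * (sqrt (\<beta> k) * \<bar>?d k x\<bar>))\<^sup>2"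
      by (intro power_mono) auto
    also have "\<dots> \<le> (\<Sum>k\<in>UNIV. (sqrt (\<beta> k))\<^sup>2) * (\<Sum>k\<in>UNIV. (sqrt (\<beta> k) * \<bar>?d k x\<bar>)\<^sup>2)"
      by (rule Cauchy_Schwarz_ineq_sum)
    also have "\<dots> = lip * (\<Sum>k\<in>UNIV. \<beta> k * (?d k x)\<^sup>2)"
      using \<beta>_pos by (simp add: lip_def power_mult_distrib less_imp_le)
    finally show "(source u t x - source v t x)\<^sup>2 \<le> lip * (\<Sum>k\<in>UNIV. \<beta> k * (?d k x)\<^sup>2)" by simp
  qed
  also have "\<dots> = lip * (\<Sum>k\<in>UNIV. \<beta> k * integral {0..1} (\<lambda>x. (?d k x)\<^sup>2))"
    by (simp add: integral_sum integrable_on_unit_interval continuous_intros d)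
  also have "\<dots> \<le> lip * (\<Sum>k\<in>UNIV. \<beta> k * M\<^sup>2)"
    using assms(3) \<beta>_pos lip_nonneg unfolding L2_le_def
    by (intro mult_left_mono sum_mono) (auto simp: less_imp_le)
  also have "\<dots> = (lip * M)\<^sup>2"
    unfolding sum_distrib_right[symmetric] lip_def[symmetric] by (simp add: power2_eq_square)
  finally show "integral {0..1} (\<lambda>x. (source u t x - source v t x)\<^sup>2) \<le> (lip * M)\<^sup>2" .
qed

text \<open>The map contracts in the \<open>L\<^sup>2\<close> norm and controls the supremum norm by the \<open>L\<^sup>2\<close> norm.\<close>

lemma picard_contraction:
  assumes "admissible u" "admissible v" "L2_le (\<lambda>t x. u t x - v t x) M" "M \<ge> 0"
  shows "L2_le (\<lambda>t x. mild (source u) t x - mild (source v) t x) (contraction * M)"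
    and "\<bar>mild (source u) t x - mild (source v) t x\<bar> \<le> smoothing_const * (lip * M)"
  using mild_diff_L2_le[OF admissible_source admissible_source source_L2_lipschitz] assms
    mild_diff_sup_le[OF admissible_source admissible_source source_L2_lipschitz] lip_nonneg
  by (simp_all add: contraction_def)

lemma fixed_point_unique:
  assumes u: "admissible u" "\<And>t x. x \<in> {0..1} \<Longrightarrow> u t x = mild (source u) t x"
    and v: "admissible v" "\<And>t x. x \<in> {0..1} \<Longrightarrow> v t x = mild (source v) t x"
    and x: "x \<in> {0..1}"
  shows "u t x = v t x"
proof -
  obtain B where "B \<ge> 0" and B: "\<And>t x. x \<in> {0..1} \<Longrightarrow> \<bar>u t x - v t x\<bar> \<le> B"
    using admissible_bounded[OF admissible_diff[OF u(1) v(1)]] by blast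
  have nn: "contraction ^ n * B \<ge> 0" for n using contraction_nonneg \<open>B \<ge> 0\<close> by simp
  have L2: "L2_le (\<lambda>t x. u t x - v t x) (contraction ^ n * B)" for n
  proof (induction n)
    case 0
    show ?case using L2_le_sup[OF admissible_diff[OF u(1) v(1)] B] by simp
  next
    case (Suc n)
    have "L2_le (\<lambda>t x. u t x - v t x) (contraction * (contraction ^ n * B))"
      by (rule L2_le_cong[OF picard_contraction(1)[OF u(1) v(1) Suc nn]])
        (simp add: u(2)[symmetric] v(2)[symmetric])
    then show ?case by (simp add: mult.assoc)
  qed
  have le: "\<bar>u t x - v t x\<bar> \<le> smoothing_const * (lip * (contraction ^ n * B))" for n
    using picard_contraction(2)[OF u(1) v(1) L2[of n] nn[of n], of t x] by (simp add: u(2)[OF x, symmetric] v(2)[OF x, symmetric])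
  have "(\<lambda>n. smoothing_const * (lip * (contraction ^ n * B))) \<longlonglongrightarrow> smoothing_const * (lip * (0 * B))"
    by (intro tendsto_intros LIMSEQ_power_zero) (use contraction_nonneg contraction_less_1 in auto)
  from LIMSEQ_le_const[OF this, of "\<bar>u t x - v t x\<bar>"] le show ?thesis by auto
qed

primrec picard :: "nat \<Rightarrow> real \<Rightarrow> real \<Rightarrow> real" where
  "picard 0 = (\<lambda>t x. 0)"
| "picard (Suc n) = mild (source (picard n))"

lemma admissible_picard: "admissible (picard n)"
proof (induction n)
  case 0
  show ?case by (simp add: admissible_def time_periodic_def case_prod_unfold)
qed (simp add: admissible_mild admissible_source)

text \<open>The supremum of the difference of consecutive iterates is controlled by the \<open>L\<^sup>2\<close> norm of the preceding
  difference, which decays geometrically; so the iterates converge uniformly.\<close>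

lemma fixed_point_exists:
  obtains u where "admissible u" "\<And>t x. x \<in> {0..1} \<Longrightarrow> u t x = mild (source u) t x"
proof -
  let ?A = "(UNIV :: real set) \<times> {0..1::real}"
  obtain B where "B \<ge> 0" and B: "\<And>t x. x \<in> {0..1} \<Longrightarrow> \<bar>picard 1 t x - picard 0 t x\<bar> \<le> B"
    using admissible_bounded[OF admissible_diff[OF admissible_picard[of 1] admissible_picard[of 0]]] by blast
  have nn: "contraction ^ n * B \<ge> 0" for n using contraction_nonneg \<open>B \<ge> 0\<close> by simp
  have L2: "L2_le (\<lambda>t x. picard (Suc n) t x - picard n t x) (contraction ^ n * B)" for n
  proof (induction n)
    case 0
    show ?case using L2_le_sup[OF admissible_diff[OF admissible_picard admissible_picard] B] by simp
  next
    case (Suc n)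
    show ?case
      using picard_contraction(1)[OF admissible_picard admissible_picard Suc nn] by (simp add: mult.assoc)
  qed
  have sup: "\<bar>picard (Suc (Suc n)) t x - picard (Suc n) t x\<bar> \<le> smoothing_const * (lip * B) * contraction ^ n" for n t x
    using picard_contraction(2)[OF admissible_picard admissible_picard L2[of n] nn[of n], of t x] by (simp add: mult_ac)
  let ?D = "\<lambda>n z. picard (Suc (Suc n)) (fst z) (snd z) - picard (Suc n) (fst z) (snd z)"
  let ?W = "\<lambda>z. (\<Sum>n. ?D n z) + picard 1 (fst z) (snd z)"
  have "uniform_limit ?A (\<lambda>N z. \<Sum>n<N. ?D n z) (\<lambda>z. \<Sum>n. ?D n z) sequentially"
  proof (rule Weierstrass_m_test)
    show "summable (\<lambda>n. smoothing_const * (lip * B) * contraction ^ n)"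
      using contraction_nonneg contraction_less_1 by (intro summable_mult summable_geometric) simp
  qed (use sup in simp)
  then have "uniform_limit ?A (\<lambda>N z. (\<Sum>n<N. ?D n z) + picard 1 (fst z) (snd z)) ?W sequentially"
    by (intro uniform_limit_add uniform_limit_const)
  moreover have "(\<Sum>n<N. ?D n z) + picard 1 (fst z) (snd z) = picard (Suc N) (fst z) (snd z)" for N z
    using sum_lessThan_telescope[of "\<lambda>n. picard (Suc n) (fst z) (snd z)" N] by simp
  ultimately have ul: "uniform_limit ?A (\<lambda>N z. picard (Suc N) (fst z) (snd z)) ?W sequentially"
    by (simp only:)
  define u where "u t x = ?W (t, x)" for t x
  have uW: "?W z = u (fst z) (snd z)" for z by (simp add: u_def)
  note ul = ul[unfolded uW]
  have pointwise: "(\<lambda>N. picard (Suc N) t x) \<longlonglongrightarrow> u t x" if "x \<in> {0..1}" for t x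
    using tendsto_uniform_limitI[OF ul, of "(t, x)"] that by simp
  have adm: "admissible u"
  proof -
    have "continuous_on ?A (\<lambda>z. u (fst z) (snd z))"
      by (rule uniform_limit_theorem[OF _ ul])
        (use admissible_picard[unfolded admissible_def case_prod_unfold] in
          \<open>auto intro!: always_eventually simp del: picard.simps\<close>)
    moreover have "u (t + \<omega>) x = u t x" if x: "x \<in> {0..1}" for t x
    proof (rule LIMSEQ_unique[OF pointwise[OF x]])
      have "picard n (t + \<omega>) x = picard n t x" for n
        using admissible_picard[of n] x by (simp add: admissible_def time_periodic_def)
      then show "(\<lambda>N. picard (Suc N) (t + \<omega>) x) \<longlonglongrightarrow> u t x" using pointwise[OF x, of t] by (simp only:)
    qed
    ultimately show ?thesis by (simp add: admissible_def time_periodic_def case_prod_unfold)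
  qed
  have "u t x = mild (source u) t x" if x: "x \<in> {0..1}" for t x
  proof (rule LIMSEQ_unique[OF LIMSEQ_Suc[OF pointwise[OF x]]])
    show "(\<lambda>n. picard (Suc (Suc n)) t x) \<longlonglongrightarrow> mild (source u) t x"
    proof (rule tendstoI)
      fix e :: real assume "e > 0"
      \<comment> \<open>\<open>C\<close> bounds the image of a uniform error; \<open>C + 1\<close> avoids a division by zero\<close>
      define C where "C = smoothing_const * lip"
      have C: "C \<ge> 0" unfolding C_def using smoothing_const_nonneg lip_nonneg by simp
      have pos: "e / (C + 1) > 0" using \<open>e > 0\<close> C by simp
      have lt: "C * (e / (C + 1)) < e" using \<open>e > 0\<close> C by (simp add: field_simps)
      from uniform_limitD[OF ul pos]
      show "\<forall>\<^sub>F n in sequentially. dist (picard (Suc (Suc n)) t x) (mild (source u) t x) < e"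
      proof eventually_elim
        case (elim n)
        have "\<bar>picard (Suc n) t x - u t x\<bar> \<le> e / (C + 1)" if "x \<in> {0..1}" for t x
          using bspec[OF elim, of "(t, x)"] that by (simp add: dist_real_def del: picard.simps)
        then have "L2_le (\<lambda>t x. picard (Suc n) t x - u t x) (e / (C + 1))"
          by (intro L2_le_sup admissible_diff admissible_picard adm)
        from picard_contraction(2)[OF admissible_picard adm this less_imp_le[OF pos], of t x]
        have "\<bar>picard (Suc (Suc n)) t x - mild (source u) t x\<bar> \<le> C * (e / (C + 1))"
          by (simp only: picard.simps(2)[of "Suc n"] C_def mult.assoc)
        then show ?case using lt unfolding dist_real_def by (rule le_less_trans)
      qed
    qed
  qed
  with adm show thesis by (rule that)
qed

text \<open>At a fixed point the data combine the Hoelder exponent of \<open>g\<close> with the exponent \<open>1/2\<close> of mild solutions.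
  The smaller exponent serves for time differences up to \<open>1\<close>; for larger ones boundedness suffices.\<close>

lemma source_time_hoelder:
  assumes "admissible u" "\<And>t x. x \<in> {0..1} \<Longrightarrow> u t x = mild (source u) t x"
  obtains L \<alpha> where "\<alpha> > 0" "L \<ge> 0"
    "\<And>s t x. x \<in> {0..1} \<Longrightarrow> \<bar>source u s x - source u t x\<bar> \<le> L * \<bar>s - t\<bar> powr \<alpha>"
proof -
  obtain \<alpha> G where \<alpha>: "0 < \<alpha>" and G: "\<forall>p\<in>UNIV \<times> {0..1}. \<forall>q\<in>UNIV \<times> {0..1}.
      dist ((\<lambda>(t, x). g t x) p) ((\<lambda>(t, x). g t x) q) \<le> G * dist p q powr \<alpha>"
    using g_hoelder unfolding hoelder_continuous_on_def by (elim exE conjE) (rule that)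
  have g: "\<bar>g s x - g t x\<bar> \<le> \<bar>G\<bar> * \<bar>s - t\<bar> powr \<alpha>" if "x \<in> {0..1}" for s t x
  proof -
    have "\<bar>g s x - g t x\<bar> \<le> G * \<bar>s - t\<bar> powr \<alpha>"
      using G[THEN bspec, THEN bspec, of "(s, x)" "(t, x)"] that by (simp add: dist_real_def dist_Pair_Pair)
    also have "\<dots> \<le> \<bar>G\<bar> * \<bar>s - t\<bar> powr \<alpha>" by (intro mult_right_mono) auto
    finally show ?thesis .
  qed
  obtain C where "C \<ge> 0" and C: "\<And>s t x. \<bar>mild (source u) s x - mild (source u) t x\<bar> \<le> C * \<bar>s - t\<bar> powr (1/2)"
    using mild_time_hoelder[OF admissible_source[OF assms(1)]] by blast
  obtain B where "B \<ge> 0" and B: "\<And>t x. x \<in> {0..1} \<Longrightarrow> \<bar>source u t x\<bar> \<le> B"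
    using admissible_bounded[OF admissible_source[OF assms(1)]] by blast
  let ?a = "min \<alpha> (1/2)"
  let ?L = "\<bar>G\<bar> + lip * C + 2 * B"
  show thesis
  proof (rule that[of ?a ?L])
    show "?a > 0" using \<alpha> by simp
    show "?L \<ge> 0" using \<open>C \<ge> 0\<close> \<open>B \<ge> 0\<close> lip_nonneg by simp
    fix s t x :: real assume x: "x \<in> {0..1}"
    let ?d = "\<bar>s - t\<bar>"
    show "\<bar>source u s x - source u t x\<bar> \<le> ?L * ?d powr ?a"
    proof (cases "?d \<le> 1")
      case True
      have "\<bar>u (s - \<tau> k) x - u (t - \<tau> k) x\<bar> \<le> C * ?d powr (1/2)" for k
        using C[of "s - \<tau> k" x "t - \<tau> k"] by (simp add: assms(2)[OF x, symmetric])
      then have "(\<Sum>k\<in>UNIV. \<beta> k * \<bar>u (s - \<tau> k) x - u (t - \<tau> k) x\<bar>) \<le> (\<Sum>k\<in>UNIV. \<beta> k * (C * ?d powr (1/2)))"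
        using \<beta>_pos by (intro sum_mono mult_left_mono) (auto simp: less_imp_le)
      also have "\<dots> = lip * C * ?d powr (1/2)" by (simp add: sum_distrib_right[symmetric] lip_def)
      finally have "\<bar>source u s x - source u t x\<bar> \<le> \<bar>G\<bar> * ?d powr \<alpha> + lip * C * ?d powr (1/2)"
        using source_diff_pointwise[of u s x u t] g[OF x, of s t] by linarith
      also have "\<dots> \<le> \<bar>G\<bar> * ?d powr ?a + lip * C * ?d powr ?a"
        using True \<alpha> \<open>C \<ge> 0\<close> lip_nonneg
        by (intro add_mono mult_left_mono powr_le_powr_min_exponent) auto
      also have "\<dots> \<le> ?L * ?d powr ?a" using \<open>B \<ge> 0\<close> by (simp add: distrib_right)
      finally show ?thesis .
    next
      case False
      then have ge: "1 \<le> ?d powr ?a" using \<alpha> by (intro ge_one_powr_ge_zero) auto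
      have "\<bar>source u s x - source u t x\<bar> \<le> 2 * B * 1" using B[OF x, of s] B[OF x, of t] by linarith
      also have "\<dots> \<le> ?L * ?d powr ?a"
        using ge \<open>C \<ge> 0\<close> \<open>B \<ge> 0\<close> lip_nonneg by (intro mult_mono) auto
      finally show ?thesis .
    qed
  qed
qed

lemma classical_solution_fixed_point:
  assumes "C12 v" "time_periodic \<omega> v" "efk_classical_solution \<gamma> \<tau> f g v"
  shows "admissible v" "x \<in> {0..1} \<Longrightarrow> v t x = mild (source v) t x"
proof -
  have "continuous_on (UNIV \<times> {0..1}) (\<lambda>(t, x). v t x)"
    using assms(1) unfolding C12_def by (elim exE conjE)
  then show adm: "admissible v" using assms(2) by (simp add: admissible_def)
  obtain vt vx vxx vxxx vxxxx where sol:
    "\<forall>t. \<forall>x\<in>{0..1}. (v t has_real_derivative vx t x) (at x within {0..1}) \<and>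
      (vx t has_real_derivative vxx t x) (at x within {0..1})"
    "\<forall>t. \<forall>x\<in>{0<..<1}. ((\<lambda>s. v s x) has_real_derivative vt t x) (at t) \<and>
      (vxx t has_real_derivative vxxx t x) (at x) \<and>
      (vxxx t has_real_derivative vxxxx t x) (at x) \<and>
      vt t x + \<gamma> * vxxxx t x - vxx t x - v t x = g t x + f (\<chi> k. v (t - \<tau> k) x)"
    "\<forall>t. v t 0 = 0 \<and> v t 1 = 0 \<and> vxx t 0 = 0 \<and> vxx t 1 = 0"
    using assms(3) unfolding efk_classical_solution_def by (elim exE conjE) (rule that)
  show "v t x = mild (source v) t x" if "x \<in> {0..1}"
    by (rule classical_imp_mild[where vt = vt and vx = vx and vxx = vxx and vxxx = vxxx and vxxxx = vxxxx,
          OF admissible_source[OF adm] assms(1,2) _ _ _ _ _ _ _ _ _ _ that])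
      (use sol in \<open>auto simp: source_def\<close>)
qed

lemma classical_solution_exists:
  "\<exists>u. C12 u \<and> time_periodic \<omega> u \<and> efk_classical_solution \<gamma> \<tau> f g u"
proof -
  obtain w where w: "admissible w" "\<And>t x. x \<in> {0..1} \<Longrightarrow> w t x = mild (source w) t x"
    by (rule fixed_point_exists) (rule that)
  let ?u = "mild (source w)"
  note adm = admissible_source[OF w(1)]
  obtain L \<alpha> where L: "\<alpha> > 0" "L \<ge> 0"
    "\<And>s t x. x \<in> {0..1} \<Longrightarrow> \<bar>source w s x - source w t x\<bar> \<le> L * \<bar>s - t\<bar> powr \<alpha>"
    by (rule source_time_hoelder[OF w]) (assumption, rule that)
  obtain ut uxxx uxxxx where u: "C12 ?u"
    "\<And>t x. x \<in> {0<..<1} \<Longrightarrow> ((\<lambda>s. ?u s x) has_real_derivative ut t x) (at t)"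
    "\<And>t x. x \<in> {0<..<1} \<Longrightarrow> (mild_xx (source w) t has_real_derivative uxxx t x) (at x)"
    "\<And>t x. x \<in> {0<..<1} \<Longrightarrow> (uxxx t has_real_derivative uxxxx t x) (at x)"
    "\<And>t x. ut t x + \<gamma> * uxxxx t x - mild_xx (source w) t x - ?u t x = source w t x"
    "\<And>t. ?u t 0 = 0" "\<And>t. ?u t 1 = 0"
    "\<And>t. mild_xx (source w) t 0 = 0" "\<And>t. mild_xx (source w) t 1 = 0"
    by (rule mild_regular[OF adm L]) (assumption, rule that)
  have src: "source w t x = g t x + f (\<chi> k. ?u (t - \<tau> k) x)" if "x \<in> {0<..<1}" for t x
    using that by (simp add: source_def w(2)[symmetric])
  have "efk_classical_solution \<gamma> \<tau> f g ?u"
    unfolding efk_classical_solution_def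
    by (rule exI[of _ ut], rule exI[of _ "mild_x (source w)"], rule exI[of _ "mild_xx (source w)"],
        rule exI[of _ uxxx], rule exI[of _ uxxxx])
      (use u(2-) src mild_spatial_derivatives(1,2)[OF adm] in
        \<open>auto intro: has_field_derivative_at_within\<close>)
  then show ?thesis using u(1) admissible_mild[OF adm] by (auto simp: admissible_def)
qed

end

theorem theorem1p2:
  fixes \<gamma> \<omega> :: real
    and \<tau> \<beta> :: "'n::finite \<Rightarrow> real"
    and f :: "real^'n \<Rightarrow> real"
    and g :: "real \<Rightarrow> real \<Rightarrow> real"
  assumes "\<gamma> > 0" and "\<omega> > 0"
    and "\<And>k. \<tau> k > 0"
    and "locally_lipschitz_on UNIV f"
    and "hoelder_continuous_on (UNIV \<times> {0..1}) (\<lambda>(t, x). g t x)"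
    and "time_periodic \<omega> g"
    and "\<And>k. \<beta> k > 0"
    and "\<And>\<xi> \<eta>. \<bar>f \<xi> - f \<eta>\<bar> \<le> (\<Sum>k\<in>UNIV. \<beta> k * \<bar>\<xi> $ k - \<eta> $ k\<bar>)"
    and "(\<Sum>k\<in>UNIV. \<beta> k) < \<gamma> * pi ^ 4 + pi ^ 2 - 1"
  shows "\<exists>u. (C12 u \<and> time_periodic \<omega> u \<and> efk_classical_solution \<gamma> \<tau> f g u) \<and>
    (\<forall>v. C12 v \<and> time_periodic \<omega> v \<and> efk_classical_solution \<gamma> \<tau> f g v \<longrightarrow>
      (\<forall>t. \<forall>x\<in>{0..1}. v t x = u t x))"
proof -
  interpret delayed_efk \<gamma> \<omega> \<tau> \<beta> f g
    using assms by unfold_locales (simp_all add: eigenval_0)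
  obtain u where u: "C12 u" "time_periodic \<omega> u" "efk_classical_solution \<gamma> \<tau> f g u"
    using classical_solution_exists by blast
  moreover have "v t x = u t x"
    if "C12 v" "time_periodic \<omega> v" "efk_classical_solution \<gamma> \<tau> f g v" "x \<in> {0..1}" for v t x
    using fixed_point_unique[OF classical_solution_fixed_point[OF that(1-3)]
        classical_solution_fixed_point[OF u] that(4)] by blast
  ultimately show ?thesis by blast
qed

end
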